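(* Let $r \ge 2$ be an integer and $p > 1$ be a real number. Suppose that $\mathcal{F}$ is a degenerate family of $r$-graphs satisfying $\mathrm{ex}(n,\mathcal{F}) = O(n^{1+\alpha})$ for some constant $\alpha \in [r-2, r-1)$. Then there exists a constant $C_{\mathcal{F}}>0$ such that $$\mathrm{ex}_{p}(n,\mathcal{F}) \le \begin{cases} C_{\mathcal{F}} \cdot n^{1+p \alpha}, & \text{if } 1 < p < \frac{1}{r-1-\alpha}, \\ \left(\tau_{\mathrm{part}}(\mathcal{F}) -1+o(1)\right)\binom{n}{r-1}^{p}, & \text{if } p > \frac{1}{r-1-\alpha}. \end{cases}$$ In particular, for $r=2$, we have, for every $p > \frac{1}{1-\alpha}$, $$\mathrm{ex}_{p}(n,\mathcal{F}) = \left(\tau_{\mathrm{ind}}(\mathcal{F})-1+o(1)\right)n^{p}.$$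
   Context: For an integer $r\ge 2$, an $r$-graph $\mathcal{H}$ is a finite $r$-uniform hypergraph, identified with its edge set, with vertex set $V(\mathcal{H})$ of size $v(\mathcal{H})$. The degree $d_{\mathcal{H}}(v)$ is the number of edges containing $v$. For a real $p\ge 0$, $\|\mathcal{H}\|_p := \sum_{v\in V(\mathcal{H})} (d_{\mathcal{H}}(v))^{p}$. Given a family $\mathcal{F}$ of $r$-graphs, an $r$-graph is $\mathcal{F}$-free if it contains no member of $\mathcal{F}$ as a (not necessarily induced) subgraph. $\mathrm{ex}(n,\mathcal{F})$ is the maximum number of edges of an $n$-vertex $\mathcal{F}$-free $r$-graph, and $\mathrm{ex}_p(n,\mathcal{F})$ is the maximum of $\|\mathcal{H}\|_p$ over all $n$-vertex $\mathcal{F}$-free $r$-graphs $\mathcal{H}$. The family $\mathcal{F}$ is degenerate if $\lim_{n\to\infty}\mathrm{ex}(n,\mathcal{F})/\binom{n}{r}=0$ (equivalently, $\mathcal{F}$ contains at least one $r$-partite $r$-graph). For an $r$-partite $r$-graph $F$: the partition number $\tau_{\mathrm{part}}(F)$ is the minimum size of a set $S_1\subseteq V(F)$ such that $V(F)\setminus S_1$ can be partitioned into $r-1$ sets $S_2,\ldots,S_r$ with each edge of $F$ containing exactly one vertex from each $S_i$, $i=1,\dots,r$. The independent covering number $\tau_{\mathrm{ind}}(F)$ is the minimum size of a set $S\subseteq V(F)$ such that every edge of $F$ contains exactly one vertex from $S$. For a family, $\tau_{\mathrm{part}}(\mathcal{F}) := \min\{\tau_{\mathrm{part}}(F): F\in\mathcal{F}\text{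 is } r\text{-partite}\}$ and $\tau_{\mathrm{ind}}(\mathcal{F}) := \min\{\tau_{\mathrm{ind}}(F): F\in\mathcal{F}\text{ is } r\text{-partite}\}$. All asymptotic notation is with respect to $n\to\infty$. *)

theory Defs
  imports Complex_Main "HOL-Library.Disjoint_Sets" "HOL-Library.Landau_Symbols"
begin

type_synonym 'a hypergraph = "'a set \<times> 'a set set"

abbreviation hverts :: "'a hypergraph \<Rightarrow> 'a set" where "hverts \<equiv> fst"
abbreviation hedges :: "'a hypergraph \<Rightarrow> 'a set set" where "hedges \<equiv> snd"

definition r_graph :: "nat \<Rightarrow> 'a hypergraph \<Rightarrow> bool" where
  "r_graph r H \<longleftrightarrow> finite (hverts H) \<and> (\<forall>e\<in>hedges H. e \<subseteq> hverts H \<and> card e = r)"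

definition hdegree :: "'a hypergraph \<Rightarrow> 'a \<Rightarrow> nat" where
  "hdegree H v = card {e \<in> hedges H. v \<in> e}"

(* Isolated vertices contribute 0 for every p, since 0 powr p = 0 even for p = 0. *)
definition degree_norm :: "real \<Rightarrow> 'a hypergraph \<Rightarrow> real" where
  "degree_norm p H = (\<Sum>v\<in>hverts H. real (hdegree H v) powr p)"

definition contains_hypergraph :: "'b hypergraph \<Rightarrow> 'a hypergraph \<Rightarrow> bool" where
  "contains_hypergraph H F \<longleftrightarrow>
     (\<exists>\<phi>. inj_on \<phi> (hverts F) \<and> \<phi> ` hverts F \<subseteq> hverts H \<and> (\<forall>e\<in>hedges F. \<phi> ` e \<in> hedges H))"

definition family_free :: "'a hypergraph set \<Rightarrow> 'b hypergraph \<Rightarrow> bool" where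
  "family_free \<F> H \<longleftrightarrow> (\<forall>F\<in>\<F>. \<not> contains_hypergraph H F)"

(* The n-vertex r-graphs are taken on the labelled vertex set {..<n}. This loses nothing:
   freeness, the number of edges and the degree norm are invariant under isomorphism. *)
definition free_r_graphs :: "nat \<Rightarrow> nat \<Rightarrow> 'a hypergraph set \<Rightarrow> nat hypergraph set" where
  "free_r_graphs r n \<F> = {H. r_graph r H \<and> hverts H = {..<n} \<and> family_free \<F> H}"

(* The finite sets under Max below are nonempty as soon as every member of the family has an
   edge, because the edgeless hypergraph on {..<n} is then free. *)
definition ex_edges :: "nat \<Rightarrow> nat \<Rightarrow> 'a hypergraph set \<Rightarrow> nat" where
  "ex_edges r n \<F> = Max ((\<lambda>H. card (hedges H)) ` free_r_graphs r n \<F>)"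

definition ex_norm :: "nat \<Rightarrow> real \<Rightarrow> nat \<Rightarrow> 'a hypergraph set \<Rightarrow> real" where
  "ex_norm r p n \<F> = Max (degree_norm p ` free_r_graphs r n \<F>)"

definition degenerate_family :: "nat \<Rightarrow> 'a hypergraph set \<Rightarrow> bool" where
  "degenerate_family r \<F> \<longleftrightarrow>
     (\<lambda>n. real (ex_edges r n \<F>) / real (n choose r)) \<longlonglongrightarrow> 0"

definition r_partition :: "nat \<Rightarrow> 'a hypergraph \<Rightarrow> (nat \<Rightarrow> 'a set) \<Rightarrow> bool" where
  "r_partition r F S \<longleftrightarrow>
     (\<Union>i\<in>{1..r}. S i) = hverts F \<and> disjoint_family_on S {1..r} \<and>
     (\<forall>e\<in>hedges F. \<forall>i\<in>{1..r}. card (e \<inter> S i) = 1)"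

definition r_partite :: "nat \<Rightarrow> 'a hypergraph \<Rightarrow> bool" where
  "r_partite r F \<longleftrightarrow> (\<exists>S. r_partition r F S)"

(* Inf on nat is the minimum of a nonempty set. The sets below are nonempty for r-partite F
   with r > 0, and for families containing an r-partite member. *)
definition tau_part :: "nat \<Rightarrow> 'a hypergraph \<Rightarrow> nat" where
  "tau_part r F = Inf {card (S 1) | S. r_partition r F S}"

definition tau_ind :: "'a hypergraph \<Rightarrow> nat" where
  "tau_ind F = Inf {card S | S. S \<subseteq> hverts F \<and> (\<forall>e\<in>hedges F. card (e \<inter> S) = 1)}"

definition tau_part_family :: "nat \<Rightarrow> 'a hypergraph set \<Rightarrow> nat" where
  "tau_part_family r \<F> = Inf (tau_part r ` {F \<in> \<F>. r_partite r F})"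

definition tau_ind_family :: "nat \<Rightarrow> 'a hypergraph set \<Rightarrow> nat" where
  "tau_ind_family r \<F> = Inf (tau_ind ` {F \<in> \<F>. r_partite r F})"

end

theory Submission
  imports Defs "HOL-Analysis.Summation_Tests" "HOL-Analysis.Convex"
begin

text \<open>
  Let \<open>\<beta> = r - 1 - \<alpha>\<close>. Everything rests on the decay of the degree sequence of a free hypergraph
  \<open>H\<close> on \<open>n\<close> vertices: the \<open>m\<close>-th largest degree is \<open>O(n ^ (r - 1) * m powr - \<beta>)\<close>
  (\<open>decreasing_degree_le\<close>). Let \<open>A\<close> consist of the \<open>m\<close> vertices of largest degree, and cut the
  vertex set into about \<open>n / m\<close> blocks of \<open>m\<close> consecutive vertices. Each edge through \<open>A\<close> lies in the
  union of \<open>A\<close> with at most \<open>r - 1\<close> blocks. Such a union has at most \<open>r * m\<close> vertices and therefore,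
  by the hypothesis on the extremal number, spans \<open>O(m powr (1 + \<alpha>))\<close> edges, and there
  are \<open>O((n / m) ^ (r - 1))\<close> of these unions (\<open>sum_hdegree_le\<close>).

  The degree norm is thus bounded in terms of the sum of the powers \<open>m powr - (\<beta> * p)\<close>.
  For \<open>p < 1 / \<beta>\<close> this sum has order \<open>n powr (1 - \<beta> * p)\<close>, which yields the first bound. For
  \<open>p > 1 / \<beta>\<close> the series converges, so that up to an arbitrarily small error only a bounded number of
  vertices matters. Their normalised degrees are at most \<open>1\<close>, hence it suffices to bound
  their degree sum by \<open>(\<tau> - 1 + o(1)) * (n choose (r - 1))\<close>, where \<open>\<tau>\<close> is the partition number of the
  family (\<open>sum_top_hdegree_less\<close>). If it were larger, a positive proportion of the
  \<open>(r - 1)\<close>-sets would lie in the links of at least \<open>\<tau>\<close> of these vertices, and by pigeonholing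
  (\<open>dense_common_intersection\<close>) \<open>\<tau>\<close> vertices would have a common link of positive density. By Erdos's theorem (\<open>dense_tuples_contain_box\<close>) that link contains
  a complete \<open>(r - 1)\<close>-partite hypergraph with large parts, and with the \<open>\<tau>\<close> vertices as an
  additional part it hosts the member of the family that attains \<open>\<tau>\<close>. There is an \<open>r\<close>-partite member at all because
  otherwise complete \<open>r\<close>-partite hypergraphs would be free, against degeneracy
  (\<open>degenerate_family_r_partite_member\<close>).

  For \<open>r = 2\<close>, independent covers are the same as classes of bipartitions, so that both covering
  numbers agree. The complete bipartite graph with parts of size \<open>\<tau> - 1\<close> and \<open>n - \<tau> + 1\<close> is free and has
  degree norm at least \<open>(\<tau> - 1) * (n - \<tau> + 1) powr p\<close>, which gives the matching lower bound.
\<close>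

section \<open>Extremal numbers as maxima\<close>

lemma finite_free_r_graphs: "finite (free_r_graphs r n \<F>)"
proof (rule finite_subset)
  show "free_r_graphs r n \<F> \<subseteq> {{..<n}} \<times> Pow (Pow {..<n})"
    by (force simp: free_r_graphs_def r_graph_def mem_Times_iff)
qed auto

lemma edgeless_in_free_r_graphs:
  assumes "\<forall>F\<in>\<F>. hedges F \<noteq> {}"
  shows "({..<n}, {}) \<in> free_r_graphs r n \<F>"
  using assms by (auto simp: free_r_graphs_def r_graph_def family_free_def contains_hypergraph_def)

lemma degree_norm_le_ex_norm:
  assumes "H \<in> free_r_graphs r n \<F>"
  shows "degree_norm p H \<le> ex_norm r p n \<F>"
  unfolding ex_norm_def using assms finite_free_r_graphs by (intro Max_ge) auto

lemma ex_norm_leI: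
  assumes "\<forall>F\<in>\<F>. hedges F \<noteq> {}"
    and "\<And>H. H \<in> free_r_graphs r n \<F> \<Longrightarrow> degree_norm p H \<le> B"
  shows "ex_norm r p n \<F> \<le> B"
  unfolding ex_norm_def
proof (rule Max.boundedI)
  show "finite (degree_norm p ` free_r_graphs r n \<F>)" using finite_free_r_graphs by blast
qed (use assms(2) edgeless_in_free_r_graphs[OF assms(1), of n r] in auto)

lemma card_hedges_le_ex_edges:
  assumes "H \<in> free_r_graphs r n \<F>"
  shows "card (hedges H) \<le> ex_edges r n \<F>"
  unfolding ex_edges_def using assms finite_free_r_graphs by (intro Max_ge) auto

lemma free_r_graphsD:
  assumes "H \<in> free_r_graphs r n \<F>"
  shows "hverts H = {..<n}" "\<And>e. e \<in> hedges H \<Longrightarrow> e \<subseteq> {..<n} \<and> card e = r \<and> finite e"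
    "finite (hedges H)" "\<And>F. F \<in> \<F> \<Longrightarrow> \<not> contains_hypergraph H F"
proof -
  show a: "hverts H = {..<n}" using assms by (simp add: free_r_graphs_def)
  show b: "\<And>e. e \<in> hedges H \<Longrightarrow> e \<subseteq> {..<n} \<and> card e = r \<and> finite e"
    using assms by (auto simp: free_r_graphs_def r_graph_def intro: finite_subset)
  show "finite (hedges H)" using b finite_subset[of "hedges H" "Pow {..<n}"] by auto
  show "\<And>F. F \<in> \<F> \<Longrightarrow> \<not> contains_hypergraph H F"
    using assms by (auto simp: free_r_graphs_def family_free_def)
qed

lemma degree_norm_no_edges:
  assumes "H \<in> free_r_graphs r n \<F>" "n < r"
  shows "degree_norm p H = 0"
proof -
  have "hedges H = {}"
    using free_r_graphsD(2)[OF assms(1)] assms(2)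
    by (metis card_lessThan card_mono equals0I finite_lessThan leD)
  then show ?thesis by (simp add: degree_norm_def hdegree_def)
qed

text \<open>Freeness passes to induced subgraphs, which become hypergraphs on \<open>{..<card W}\<close> after
  relabelling, so a sparse extremal function controls the density of \<open>H\<close> on every
  small vertex set.\<close>

lemma card_induced_edges_le:
  assumes H: "H \<in> free_r_graphs r n \<F>" and W: "W \<subseteq> {..<n}"
    and fam: "\<forall>F\<in>\<F>. r_graph r F"
  shows "card {e \<in> hedges H. e \<subseteq> W} \<le> ex_edges r (card W) \<F>"
proof -
  note HD = free_r_graphsD[OF H]
  have finW: "finite W" using W finite_subset by blast
  obtain h where h: "bij_betw h W {..<card W}"
    using ex_bij_betw_finite_nat[OF finW] by (auto simp: atLeast0LessThan)
  have hinj: "inj_on h W" and him: "h ` W = {..<card W}" using h by (auto simp: bij_betw_def)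
  define g where "g = inv_into W h"
  have g: "inj_on g {..<card W}" "g ` {..<card W} = W"
    using bij_betw_inv_into[OF h] by (auto simp: bij_betw_def g_def)
  have gh: "g ` h ` e = e" if "e \<subseteq> W" for e
    unfolding g_def using hinj that by (rule inv_into_image_cancel)
  define E where "E = {e \<in> hedges H. e \<subseteq> W}"
  define H' where "H' = ({..<card W}, (`) h ` E)"
  have "H' \<in> free_r_graphs r (card W) \<F>"
  proof -
    have "card (h ` e) = r" if "e \<in> E" for e
      using that HD(2) card_image[OF inj_on_subset[OF hinj, of e]] by (auto simp: E_def)
    moreover have "h ` e \<subseteq> {..<card W}" if "e \<in> E" for e
      using that him by (auto simp: E_def)
    ultimately have "r_graph r H'" by (auto simp: r_graph_def H'_def)
    moreover have "\<not> contains_hypergraph H' F" if F: "F \<in> \<F>" for F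
    proof
      assume "contains_hypergraph H' F"
      then obtain \<phi> where \<phi>: "inj_on \<phi> (hverts F)" "\<phi> ` hverts F \<subseteq> {..<card W}"
        "\<forall>e\<in>hedges F. \<phi> ` e \<in> (`) h ` E"
        by (auto simp: contains_hypergraph_def H'_def)
      have "inj_on (g \<circ> \<phi>) (hverts F)"
        using comp_inj_on[OF \<phi>(1) inj_on_subset[OF g(1) \<phi>(2)]] .
      moreover have "(g \<circ> \<phi>) ` hverts F \<subseteq> hverts H"
        unfolding image_comp[symmetric] HD(1) using image_mono[OF \<phi>(2), of g] g(2) W by simp
      moreover have "(g \<circ> \<phi>) ` e \<in> hedges H" if "e \<in> hedges F" for e
      proof -
        have "\<phi> ` e \<in> (`) h ` E" using \<phi>(3) that by (rule bspec)
        then obtain d where d: "d \<in> E" "\<phi> ` e = h ` d" by (rule imageE)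
        then have "(g \<circ> \<phi>) ` e = d" using gh[of d] by (simp only: image_comp[symmetric] E_def mem_Collect_eq)
        then show ?thesis using d by (simp add: E_def)
      qed
      ultimately have "contains_hypergraph H F" unfolding contains_hypergraph_def by blast
      then show False using HD(4)[OF F] by blast
    qed
    ultimately show ?thesis by (simp add: free_r_graphs_def family_free_def H'_def)
  qed
  then have "card ((`) h ` E) \<le> ex_edges r (card W) \<F>"
    using card_hedges_le_ex_edges[of H'] by (simp add: H'_def)
  moreover have "inj_on ((`) h) E"
    by (rule inj_on_inverseI[where g = "(`) g"]) (auto simp: E_def gh)
  ultimately show ?thesis by (simp add: card_image E_def)
qed

section \<open>The decay of the degree sequence\<close>

text \<open>Cutting the vertex set into about \<open>n / card A\<close> blocks of length \<open>card A\<close>, each edge through a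
  vertex of \<open>A\<close> has its other \<open>r - 1\<close> vertices in the union of at most \<open>r - 1\<close> blocks.
  Together with \<open>A\<close> these blocks span only \<open>r * card A\<close> vertices, hence few edges, and the number of
  choices of the blocks is at most \<open>(n div card A + 1) ^ (r - 1)\<close>.\<close>

lemma sum_hdegree_le:
  fixes K \<alpha> :: real
  assumes H: "H \<in> free_r_graphs r n \<F>" and A: "A \<subseteq> {..<n}" "A \<noteq> {}"
    and fam: "\<forall>F\<in>\<F>. r_graph r F" and r: "r \<ge> 1"
    and K: "\<And>k. real (ex_edges r k \<F>) \<le> K * real k powr (1 + \<alpha>)" and \<alpha>: "1 + \<alpha> \<ge> 0" and "K \<ge> 0"
  shows "(\<Sum>v\<in>A. real (hdegree H v))
     \<le> real r * real (n div card A + 1) ^ (r - 1) * (K * real (r * card A) powr (1 + \<alpha>))"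
proof -
  note HD = free_r_graphsD[OF H]
  have finA: "finite A" using A finite_subset by blast
  define m where "m = card A"
  have m: "m > 0" using finA A by (simp add: m_def card_gt_0_iff)
  define E where "E = {e \<in> hedges H. e \<inter> A \<noteq> {}}"
  have finE: "finite E" using HD(3) by (simp add: E_def)
  have "(\<Sum>v\<in>A. hdegree H v) = (\<Sum>v\<in>A. card {e\<in>E. v \<in> e})"
    unfolding hdegree_def E_def by (intro sum.cong refl arg_cong[of _ _ card]) auto
  also have "\<dots> = (\<Sum>e\<in>E. card {v\<in>A. v \<in> e})"
    by (rule sum_multicount_gen[OF finA finE]) auto
  also have "\<dots> \<le> (\<Sum>e\<in>E. r)"
  proof (rule sum_mono)
    fix e assume "e \<in> E"
    then have "finite e" "card e = r" using HD(2) by (auto simp: E_def)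
    then show "card {v \<in> A. v \<in> e} \<le> r" using card_mono[of e "{v\<in>A. v\<in>e}"] by auto
  qed
  finally have deg: "(\<Sum>v\<in>A. hdegree H v) \<le> r * card E" by (simp add: mult.commute)
  \<comment> \<open>The vertex \<open>c e\<close> is set aside because it lies in \<open>A\<close> already: only the
    \<open>r - 1\<close> blocks of the other vertices are recorded, whence the exponent \<open>r - 1\<close>.\<close>
  define c where "c e = (SOME v. v \<in> e \<inter> A)" for e
  have c: "c e \<in> e \<inter> A" if "e \<in> E" for e
    unfolding c_def using that by (intro someI_ex[of "\<lambda>v. v \<in> e \<inter> A"]) (auto simp: E_def)
  define N where "N = n div m + 1"
  define J where "J e = (\<lambda>x. x div m) ` (e - {c e})" for e
  define \<J> where "\<J> = set ` {xs. set xs \<subseteq> {..<N} \<and> length xs = r - 1}"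
  define W where "W j = A \<union> (\<Union>i\<in>j. {x \<in> {..<n}. x div m = i})" for j :: "nat set"
  have fin\<J>: "finite \<J>" unfolding \<J>_def by (intro finite_imageI finite_lists_length_eq) auto
  have card\<J>: "card \<J> \<le> N ^ (r - 1)"
    unfolding \<J>_def using card_image_le[OF finite_lists_length_eq[of "{..<N}" "r - 1"], of set]
    by (simp add: card_lists_length_eq)
  have J: "J e \<in> \<J>" if e: "e \<in> E" for e
  proof -
    have e': "e \<subseteq> {..<n}" "card e = r" "finite e" using HD(2) e by (auto simp: E_def)
    obtain ys where ys: "set ys = e - {c e}" "distinct ys"
      using finite_distinct_list[of "e - {c e}"] e' by auto
    have "length ys = r - 1"
    proof -
      have "length ys = card (e - {c e})" using distinct_card[OF ys(2)] by (simp only: ys(1))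
      also have "\<dots> = r - 1" using c[OF e] e' by (simp only: card_Diff_singleton Int_iff)
      finally show ?thesis .
    qed
    moreover have "x div m < N" if "x \<in> set ys" for x
    proof -
      have "x \<in> {..<n}" using that ys(1) e'(1) by blast
      then have "x \<le> n" by simp
      then show ?thesis unfolding N_def by (simp add: div_le_mono le_imp_less_Suc)
    qed
    ultimately have "map (\<lambda>x. x div m) ys \<in> {xs. set xs \<subseteq> {..<N} \<and> length xs = r - 1}" by auto
    then show ?thesis unfolding \<J>_def J_def ys(1)[symmetric] set_map[symmetric] by blast
  qed
  have W: "W j \<subseteq> {..<n}" for j using A by (auto simp: W_def)
  have cardW: "card (W j) \<le> r * m" if j: "j \<in> \<J>" for j
  proof -
    obtain xs where xs: "j = set xs" "length xs = r - 1" using j by (auto simp: \<J>_def)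
    have block: "card {x \<in> {..<n}. x div m = i} \<le> m" for i
    proof -
      have "{x \<in> {..<n}. x div m = i} \<subseteq> {i * m..<i * m + m}"
      proof
        fix x assume "x \<in> {x \<in> {..<n}. x div m = i}"
        then have "i = x div m" by simp
        moreover have "x < m + x div m * m" using dividend_less_div_times[OF m] .
        moreover have "x div m * m \<le> x" by (rule div_times_less_eq_dividend)
        ultimately show "x \<in> {i * m..<i * m + m}" by (simp only: atLeastLessThan_iff add.commute simp_thms)
      qed
      then have "card {x \<in> {..<n}. x div m = i} \<le> card {i * m..<i * m + m}"
        by (intro card_mono) auto
      then show ?thesis by simp
    qed
    have "card (\<Union>i\<in>j. {x \<in> {..<n}. x div m = i}) \<le> (\<Sum>i\<in>j. card {x \<in> {..<n}. x div m = i})"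
      using xs by (intro card_UN_le) auto
    also have "\<dots> \<le> card j * m" using sum_bounded_above[of j _ m] block by simp
    also have "\<dots> \<le> (r - 1) * m" using xs card_length[of xs] by simp
    finally have "card (W j) \<le> m + (r - 1) * m"
      unfolding W_def m_def by (intro order_trans[OF card_Un_le] add_left_mono)
    also have "\<dots> = r * m" using r by (cases r) auto
    finally show ?thesis .
  qed
  have sub: "e \<in> {e \<in> hedges H. e \<subseteq> W (J e)}" if e: "e \<in> E" for e
    using that c[OF e] HD(2) by (auto simp: E_def W_def J_def)
  have "E \<subseteq> (\<Union>j\<in>\<J>. {e \<in> hedges H. e \<subseteq> W j})" using J sub by blast
  then have "card E \<le> card (\<Union>j\<in>\<J>. {e \<in> hedges H. e \<subseteq> W j})"
    using fin\<J> HD(3) by (intro card_mono) auto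
  also have "\<dots> \<le> (\<Sum>j\<in>\<J>. card {e \<in> hedges H. e \<subseteq> W j})" by (rule card_UN_le[OF fin\<J>])
  finally have "real (card E) \<le> (\<Sum>j\<in>\<J>. real (card {e \<in> hedges H. e \<subseteq> W j}))"
    unfolding of_nat_sum[symmetric] by (rule of_nat_mono)
  also have "\<dots> \<le> (\<Sum>j\<in>\<J>. K * real (r * m) powr (1 + \<alpha>))"
  proof (rule sum_mono)
    fix j assume j: "j \<in> \<J>"
    have "real (card {e \<in> hedges H. e \<subseteq> W j}) \<le> real (ex_edges r (card (W j)) \<F>)"
      using card_induced_edges_le[OF H W fam] by simp
    also have "\<dots> \<le> K * real (card (W j)) powr (1 + \<alpha>)" by (rule K)
    also have "\<dots> \<le> K * real (r * m) powr (1 + \<alpha>)"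
      using cardW[OF j] \<alpha> \<open>K \<ge> 0\<close> by (intro mult_left_mono powr_mono2) (auto simp del: of_nat_mult)
    finally show "real (card {e \<in> hedges H. e \<subseteq> W j}) \<le> K * real (r * m) powr (1 + \<alpha>)" .
  qed
  also have "\<dots> = real (card \<J>) * (K * real (r * m) powr (1 + \<alpha>))" by simp
  also have "\<dots> \<le> real (N ^ (r - 1)) * (K * real (r * m) powr (1 + \<alpha>))"
    using card\<J> \<open>K \<ge> 0\<close> by (intro mult_right_mono of_nat_mono) auto
  finally have "real r * real (card E) \<le> real r * (real N ^ (r - 1) * (K * real (r * m) powr (1 + \<alpha>)))"
    by (intro mult_left_mono) auto
  moreover have "(\<Sum>v\<in>A. real (hdegree H v)) \<le> real r * real (card E)"
    unfolding of_nat_sum[symmetric] of_nat_mult[symmetric] using deg by (rule of_nat_mono)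
  ultimately show ?thesis by (simp add: N_def m_def mult.assoc)
qed

lemma decreasing_enumeration:
  fixes d :: "nat \<Rightarrow> nat"
  obtains \<sigma> where "bij_betw \<sigma> {..<n} {..<n}" "\<And>i j. i \<le> j \<Longrightarrow> j < n \<Longrightarrow> d (\<sigma> j) \<le> d (\<sigma> i)"
proof -
  define xs where "xs = rev (sort_key d [0..<n])"
  have len: "length xs = n" and dist: "distinct xs" and st: "set xs = {..<n}"
    by (auto simp: xs_def)
  have "sorted (map d (sort_key d [0..<n]))" by simp
  then have "sorted_wrt (\<ge>) (map d xs)"
    unfolding xs_def rev_map[symmetric] by (simp add: sorted_wrt_rev)
  then have *: "i < j \<Longrightarrow> j < n \<Longrightarrow> d (xs ! j) \<le> d (xs ! i)" for i j
    using len by (auto simp: sorted_wrt_iff_nth_less)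
  show ?thesis
  proof
    show "bij_betw ((!) xs) {..<n} {..<n}" by (rule bij_betw_nth[OF dist]) (simp_all add: len st)
    fix i j assume "i \<le> j" "j < n"
    then show "d (xs ! j) \<le> d (xs ! i)" using *[of i j] by (cases "i = j") auto
  qed
qed

text \<open>The bound on degree sums is applied to the \<open>m = i + 1\<close> vertices of largest degree, all of which
  have at least the degree of the \<open>i\<close>-th one: \<open>m * d\<close> is at most a constant times
  \<open>(n / m) ^ (r - 1) * m powr (1 + \<alpha>)\<close>.\<close>

lemma decreasing_degree_le:
  fixes K \<alpha> :: real
  assumes H: "H \<in> free_r_graphs r n \<F>" and \<sigma>: "inj_on \<sigma> {..<n}" "\<sigma> ` {..<n} \<subseteq> {..<n}"
    and dec: "\<And>i j. i \<le> j \<Longrightarrow> j < n \<Longrightarrow> hdegree H (\<sigma> j) \<le> hdegree H (\<sigma> i)"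
    and fam: "\<forall>F\<in>\<F>. r_graph r F" and r: "r \<ge> 1"
    and K: "\<And>k. real (ex_edges r k \<F>) \<le> K * real k powr (1 + \<alpha>)" and \<alpha>: "1 + \<alpha> \<ge> 0" and "K \<ge> 0"
    and i: "i < n"
  shows "real (hdegree H (\<sigma> i)) \<le> real r * 2 ^ (r - 1) * K * real r powr (1 + \<alpha>)
           * real n ^ (r - 1) * real (Suc i) powr - (real r - 1 - \<alpha>)"
proof -
  define A where "A = \<sigma> ` {..i}"
  define m where "m = real (Suc i)"
  define d where "d = real (hdegree H (\<sigma> i))"
  have m: "m > 0" by (simp add: m_def)
  have sub: "{..i} \<subseteq> {..<n}" using i by auto
  have cA: "card A = Suc i"
    unfolding A_def using card_image[OF inj_on_subset[OF \<sigma>(1) sub]] by simp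
  have A: "A \<subseteq> {..<n}" "A \<noteq> {}"
    unfolding A_def using image_mono[OF sub, of \<sigma>] \<sigma>(2) by auto
  have "m * d = (\<Sum>v\<in>A. d)" by (simp add: cA m_def)
  also have "\<dots> \<le> (\<Sum>v\<in>A. real (hdegree H v))"
    using dec i by (intro sum_mono) (auto simp: A_def d_def)
  also have "\<dots> \<le> real r * real (n div Suc i + 1) ^ (r - 1) * (K * real (r * Suc i) powr (1 + \<alpha>))"
    using sum_hdegree_le[OF H A fam r K \<alpha> \<open>K \<ge> 0\<close>] unfolding cA .
  also have "\<dots> \<le> real r * (2 * real n / m) ^ (r - 1) * (K * real (r * Suc i) powr (1 + \<alpha>))"
  proof (intro mult_right_mono mult_left_mono power_mono)
    \<comment> \<open>\<open>i < n\<close> makes \<open>n / m\<close> at least \<open>1\<close>, which absorbs the rounding of the number of blocks.\<close>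
    have "real (n div Suc i) \<le> real n / m" unfolding m_def by (rule of_nat_div_le_of_nat)
    moreover have "1 \<le> real n / m" using i by (simp add: m_def)
    ultimately show "real (n div Suc i + 1) \<le> 2 * real n / m" by simp
  qed (use \<open>K \<ge> 0\<close> in auto)
  also have "real (r * Suc i) powr (1 + \<alpha>) = real r powr (1 + \<alpha>) * m powr (1 + \<alpha>)"
    unfolding m_def of_nat_mult by (rule powr_mult)
  also have "real r * (2 * real n / m) ^ (r - 1) * (K * (real r powr (1 + \<alpha>) * m powr (1 + \<alpha>)))
     = (real r * 2 ^ (r - 1) * K * real r powr (1 + \<alpha>) * real n ^ (r - 1)) * (m powr (1 + \<alpha>) / m ^ (r - 1))"
    by (simp add: power_divide power_mult_distrib)
  also have "m powr (1 + \<alpha>) / m ^ (r - 1) = m * m powr - (real r - 1 - \<alpha>)"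
  proof -
    have "m ^ (r - 1) = m powr (real r - 1)" using m r by (simp add: powr_realpow[symmetric] of_nat_diff)
    then have "m powr (1 + \<alpha>) / m ^ (r - 1) = m powr (1 + - (real r - 1 - \<alpha>))"
      by (simp add: powr_diff[symmetric] algebra_simps)
    also have "\<dots> = m powr 1 * m powr - (real r - 1 - \<alpha>)" by (rule powr_add)
    finally show ?thesis using m by simp
  qed
  finally have "m * d \<le> m * (real r * 2 ^ (r - 1) * K * real r powr (1 + \<alpha>) * real n ^ (r - 1) * m powr - (real r - 1 - \<alpha>))"
    by (simp add: algebra_simps)
  then show ?thesis using m by (simp add: d_def m_def)
qed

lemma bigo_powr_bound:
  fixes f :: "nat \<Rightarrow> real"
  assumes f: "f \<in> O(\<lambda>n. real n powr a)" and f0: "f 0 \<le> 0" and a: "a \<ge> 0"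
  obtains K where "K \<ge> 0" "\<And>n. f n \<le> K * real n powr a"
proof -
  obtain c where "c > 0" and c: "\<forall>\<^sub>F n in sequentially. norm (f n) \<le> c * norm (real n powr a)"
    using landau_o.bigE[OF f] by blast
  then obtain n0 where n0: "\<And>n. n \<ge> n0 \<Longrightarrow> \<bar>f n\<bar> \<le> c * (real n powr a)"
    unfolding eventually_sequentially by auto
  define K where "K = c + (\<Sum>n<n0. \<bar>f n\<bar>)"
  show ?thesis
  proof
    show "K \<ge> 0" using \<open>c > 0\<close> by (simp add: K_def sum_nonneg)
    fix n
    show "f n \<le> K * real n powr a"
    proof (cases "n = 0")
      case False
      have p: "real n powr a \<ge> 1" using False a by (simp add: ge_one_powr_ge_zero)
      show ?thesis
      proof (cases "n < n0")
        case True
        have "\<bar>f n\<bar> \<le> (\<Sum>n<n0. \<bar>f n\<bar>)" using True by (intro member_le_sum) auto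
        then have "f n \<le> K" using \<open>c > 0\<close> unfolding K_def by linarith
        also have "\<dots> \<le> K * real n powr a" using p \<open>K \<ge> 0\<close> mult_left_mono by fastforce
        finally show ?thesis .
      next
        case False
        have "c * real n powr a \<le> K * real n powr a"
          unfolding K_def by (intro mult_right_mono) (auto simp: sum_nonneg)
        then show ?thesis using n0[of n] False by linarith
      qed
    qed (use f0 in simp)
  qed
qed

section \<open>Complete multipartite subgraphs in dense hypergraphs\<close>

text \<open>Points covered fewer than \<open>t\<close> times contribute at most \<open>t - 1\<close> each to the sum of the
  cardinalities, so the surplus \<open>\<eta>\<close> forces a positive proportion of \<open>Y\<close> to be covered at least
  \<open>t\<close> times; by the pigeonhole principle one of the at most \<open>2 ^ card L\<close> subsets of size \<open>t\<close> is
  responsible for a positive proportion of these points. The loss depends only on the size of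
  \<open>L\<close>, not on that of \<open>Y\<close>.\<close>

lemma dense_common_intersection:
  fixes E :: "'b \<Rightarrow> 'c set" and \<eta> :: real
  assumes L: "finite L" and Y: "finite Y" "Y \<noteq> {}" and E: "\<And>x. x \<in> L \<Longrightarrow> E x \<subseteq> Y"
    and t: "t \<ge> 1" and \<eta>: "\<eta> > 0"
    and sum: "(\<Sum>x\<in>L. real (card (E x))) \<ge> (real t - 1 + \<eta>) * real (card Y)"
  obtains T where "T \<subseteq> L" "card T = t"
    "\<eta> * real (card Y) \<le> real (card L) * 2 ^ card L * real (card {y \<in> Y. \<forall>x\<in>T. y \<in> E x})"
proof -
  define c where "c y = card {x \<in> L. y \<in> E x}" for y
  define W where "W = {y \<in> Y. t \<le> c y}"
  define C where "C T = {y \<in> Y. \<forall>x\<in>T. y \<in> E x}" for T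
  define \<T> where "\<T> = {T. T \<subseteq> L \<and> card T = t}"
  define M where "M = real (card L)"
  have WY: "W \<subseteq> Y" "finite W" using Y by (auto simp: W_def)
  have fin\<T>: "finite \<T>" unfolding \<T>_def by (rule finite_subset[of _ "Pow L"]) (use L in auto)
  have "card \<T> \<le> card (Pow L)" unfolding \<T>_def by (rule card_mono) (use L in auto)
  then have card\<T>: "real (card \<T>) \<le> 2 ^ card L" by (metis card_Pow[OF L] of_nat_le_iff of_nat_numeral of_nat_power)
  have "(\<Sum>x\<in>L. card (E x)) = (\<Sum>x\<in>L. card {y \<in> Y. y \<in> E x})"
    using E by (intro sum.cong arg_cong[of _ _ card]) auto
  also have "\<dots> = (\<Sum>y\<in>Y. c y)"
    by (rule sum_multicount_gen[OF L Y(1)]) (simp add: c_def)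
  finally have "(\<Sum>x\<in>L. real (card (E x))) = (\<Sum>y\<in>Y. real (c y))"
    by (simp only: of_nat_sum[symmetric])
  also have "\<dots> = (\<Sum>y\<in>W. real (c y)) + (\<Sum>y\<in>Y - W. real (c y))"
    using WY Y by (simp add: sum.subset_diff add.commute)
  also have "\<dots> \<le> (\<Sum>y\<in>W. M) + (\<Sum>y\<in>Y - W. real t - 1)"
  proof (intro add_mono sum_mono)
    show "real (c y) \<le> M" for y unfolding c_def M_def using L by (intro of_nat_mono card_mono) auto
    fix y assume "y \<in> Y - W"
    then have "c y < t" by (auto simp: W_def)
    then show "real (c y) \<le> real t - 1" by linarith
  qed
  also have "\<dots> \<le> M * real (card W) + (real t - 1) * real (card Y)"
  proof -
    have "(real t - 1) * real (card (Y - W)) \<le> (real t - 1) * real (card Y)"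
      using t Y by (intro mult_left_mono of_nat_mono card_mono) auto
    then show ?thesis by (simp add: mult.commute)
  qed
  finally have cW: "\<eta> * real (card Y) \<le> M * real (card W)" using sum by (simp add: algebra_simps)
  have "W \<subseteq> (\<Union>T\<in>\<T>. C T)"
  proof
    fix y assume y: "y \<in> W"
    then obtain T where "T \<subseteq> {x \<in> L. y \<in> E x}" "card T = t"
      unfolding W_def c_def using obtain_subset_with_card_n by blast
    then have "T \<in> \<T>" "y \<in> C T" using y by (auto simp: \<T>_def C_def W_def)
    then show "y \<in> (\<Union>T\<in>\<T>. C T)" by blast
  qed
  then have "card W \<le> card (\<Union>T\<in>\<T>. C T)" using fin\<T> Y by (intro card_mono) (auto simp: C_def)
  also have "\<dots> \<le> (\<Sum>T\<in>\<T>. card (C T))" by (rule card_UN_le[OF fin\<T>])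
  finally have cW': "real (card W) \<le> (\<Sum>T\<in>\<T>. real (card (C T)))"
    unfolding of_nat_sum[symmetric] by (rule of_nat_mono)
  have pos: "\<eta> * real (card Y) > 0" using \<eta> Y by (simp add: card_gt_0_iff)
  have "M \<ge> 0" by (simp add: M_def)
  have "\<exists>T\<in>\<T>. \<eta> * real (card Y) \<le> M * 2 ^ card L * real (card (C T))"
  proof (rule ccontr)
    assume "\<not> ?thesis"
    then have small: "M * 2 ^ card L * real (card (C T)) < \<eta> * real (card Y)" if "T \<in> \<T>" for T
      using that by force
    have "\<T> \<noteq> {}" using cW cW' pos by auto
    have "2 ^ card L * (\<eta> * real (card Y)) \<le> 2 ^ card L * (M * (\<Sum>T\<in>\<T>. real (card (C T))))"
      using cW cW' \<open>M \<ge> 0\<close> by (intro mult_left_mono order_trans[OF cW] mult_left_mono) auto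
    also have "\<dots> = (\<Sum>T\<in>\<T>. M * 2 ^ card L * real (card (C T)))"
      by (simp add: sum_distrib_left mult_ac)
    also have "\<dots> < (\<Sum>T\<in>\<T>. \<eta> * real (card Y))"
      using small fin\<T> \<open>\<T> \<noteq> {}\<close> by (intro sum_strict_mono) auto
    also have "\<dots> = real (card \<T>) * (\<eta> * real (card Y))" by simp
    also have "\<dots> \<le> 2 ^ card L * (\<eta> * real (card Y))"
      using card\<T> pos by (intro mult_right_mono) auto
    finally show False by simp
  qed
  then show ?thesis using that by (auto simp: \<T>_def C_def M_def)
qed

lemma listset_iff: "xs \<in> listset As \<longleftrightarrow> list_all2 (\<in>) xs As"
proof (induction As arbitrary: xs)
  case (Cons A As)
  then show ?case by (cases xs) (auto simp: set_Cons_def)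
qed simp

text \<open>Erdos's theorem on complete \<open>k\<close>-partite subgraphs, for sets of \<open>k\<close>-tuples of positive density.
  In the induction step, a large constant number of first coordinates with dense links is picked;
  their links cover the tuples of the remaining coordinates \<open>t\<close> times on average, so \<open>t\<close> of
  them have a dense common link, to which the induction hypothesis applies.\<close>

lemma dense_tuples_contain_box:
  fixes \<delta> :: real
  assumes "\<delta> > 0" and t: "t \<ge> 1"
  shows "\<exists>n0. \<forall>n\<ge>n0. \<forall>E. E \<subseteq> {xs. set xs \<subseteq> {..<n} \<and> length xs = k} \<longrightarrow> \<delta> * real n ^ k \<le> real (card E)
           \<longrightarrow> (\<exists>As. length As = k \<and> (\<forall>A\<in>set As. finite A \<and> card A = t) \<and> listset As \<subseteq> E)"
  using \<open>\<delta> > 0\<close>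
proof (induction k arbitrary: \<delta>)
  case 0
  show ?case
  proof (intro exI[of _ 0] allI impI)
    fix n :: nat and E :: "nat list set"
    assume "E \<subseteq> {xs. set xs \<subseteq> {..<n} \<and> length xs = 0}" "\<delta> * real n ^ 0 \<le> real (card E)"
    moreover from this 0 have "E \<noteq> {}" by auto
    ultimately have "[] \<in> E" by auto
    then show "\<exists>As. length As = 0 \<and> (\<forall>A\<in>set As. finite A \<and> card A = t) \<and> listset As \<subseteq> E"
      by (intro exI[of _ "[]"]) auto
  qed
next
  case (Suc k)
  \<comment> \<open>\<open>M\<close> links, each of density at least \<open>\<delta> / 2\<close>, cover the \<open>k\<close>-tuples \<open>t\<close> times on average.\<close>
  define M where "M = nat \<lceil>2 * real t / \<delta>\<rceil>"
  have M: "2 * real t / \<delta> \<le> real M" unfolding M_def by linarith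
  then have "M > 0" using t Suc.prems by (smt (verit) divide_pos_pos of_nat_0_less_iff of_nat_1 of_nat_mono)
  define \<delta>' where "\<delta>' = 1 / (real M * 2 ^ M)"
  have "\<delta>' > 0" using \<open>M > 0\<close> by (simp add: \<delta>'_def)
  from Suc.IH[OF this] obtain n1 where n1: "\<forall>n\<ge>n1. \<forall>E. E \<subseteq> {xs. set xs \<subseteq> {..<n} \<and> length xs = k} \<longrightarrow>
      \<delta>' * real n ^ k \<le> real (card E) \<longrightarrow>
      (\<exists>As. length As = k \<and> (\<forall>A\<in>set As. finite A \<and> card A = t) \<and> listset As \<subseteq> E)"
    by (rule exE)
  define n0 where "n0 = max (max n1 1) (nat \<lceil>2 * real M / \<delta>\<rceil>)"
  show ?case
  proof (intro exI[of _ n0] allI impI)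
    fix n :: nat and E :: "nat list set"
    assume n: "n0 \<le> n" and E: "E \<subseteq> {xs. set xs \<subseteq> {..<n} \<and> length xs = Suc k}"
      and cE: "\<delta> * real n ^ Suc k \<le> real (card E)"
    have nn: "n \<ge> n1" "n \<ge> 1" "2 * real M / \<delta> \<le> real n"
      using n unfolding n0_def by (simp, simp, linarith)
    have finE: "finite E" by (rule finite_subset[OF E]) (simp add: finite_lists_length_eq)
    define Y where "Y = {xs. set xs \<subseteq> {..<n} \<and> length xs = k}"
    have Y: "finite Y" "card Y = n ^ k"
      unfolding Y_def by (simp_all add: finite_lists_length_eq card_lists_length_eq)
    have "Y \<noteq> {}" using Y nn by (metis card.empty not_one_le_zero power_not_zero)
    define N where "N x = {xs. x # xs \<in> E}" for x
    have NY: "N x \<subseteq> Y" for x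
    proof
      fix xs assume "xs \<in> N x"
      then have "x # xs \<in> {xs. set xs \<subseteq> {..<n} \<and> length xs = Suc k}" using E by (auto simp only: N_def mem_Collect_eq)
      then show "xs \<in> Y" by (simp add: Y_def)
    qed
    have finN: "finite (N x)" for x using NY Y(1) finite_subset by blast
    have cN: "card (N x) \<le> n ^ k" for x using card_mono[OF Y(1) NY] Y(2) by simp
    have "E \<subseteq> (\<Union>x\<in>{..<n}. (#) x ` N x)"
    proof
      fix xs assume xs: "xs \<in> E"
      then have "xs \<in> {xs. set xs \<subseteq> {..<n} \<and> length xs = Suc k}" using E by blast
      then obtain y ys where "xs = y # ys" "y < n" by (cases xs) auto
      then show "xs \<in> (\<Union>x\<in>{..<n}. (#) x ` N x)" using xs by (auto simp: N_def)
    qed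
    then have "card E \<le> card (\<Union>x\<in>{..<n}. (#) x ` N x)" by (rule card_mono[rotated]) (simp add: finN)
    also have "\<dots> \<le> (\<Sum>x<n. card ((#) x ` N x))" by (rule card_UN_le) simp
    also have "\<dots> = (\<Sum>x<n. card (N x))" by (intro sum.cong card_image) auto
    finally have "real (card E) \<le> (\<Sum>x<n. real (card (N x)))"
      unfolding of_nat_sum[symmetric] by (rule of_nat_mono)
    define G where "G = {x \<in> {..<n}. \<delta> / 2 * real n ^ k \<le> real (card (N x))}"
    have G: "G \<subseteq> {..<n}" "finite G" by (auto simp: G_def)
    have "\<delta> * real n ^ Suc k \<le> (\<Sum>x<n. real (card (N x)))"
      using cE \<open>real (card E) \<le> _\<close> by linarith
    also have "\<dots> = (\<Sum>x\<in>G. real (card (N x))) + (\<Sum>x\<in>{..<n} - G. real (card (N x)))"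
      using G by (simp add: sum.subset_diff add.commute)
    also have "\<dots> \<le> (\<Sum>x\<in>G. real n ^ k) + (\<Sum>x\<in>{..<n} - G. \<delta> / 2 * real n ^ k)"
    proof (intro add_mono sum_mono)
      show "real (card (N x)) \<le> real n ^ k" for x using cN[of x] by (metis of_nat_le_iff of_nat_power)
    qed (auto simp: G_def)
    also have "\<dots> \<le> real (card G) * real n ^ k + real n * (\<delta> / 2 * real n ^ k)"
      using card_mono[of "{..<n}" "{..<n} - G"] Suc.prems by (auto intro!: mult_right_mono)
    finally have "(\<delta> / 2 * real n) * real n ^ k \<le> real (card G) * real n ^ k"
      by (simp add: algebra_simps)
    then have "\<delta> / 2 * real n \<le> real (card G)" using nn(2) by simp
    moreover have "real M \<le> \<delta> / 2 * real n" using nn(3) Suc.prems by (simp add: field_simps)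
    ultimately have "M \<le> card G" by linarith
    then obtain L where L: "L \<subseteq> G" "card L = M" "finite L"
      using obtain_subset_with_card_n by metis
    have "(real t - 1 + 1) * real (card Y) \<le> (\<Sum>x\<in>L. \<delta> / 2 * real n ^ k)"
    proof -
      have "real t \<le> real M * (\<delta> / 2)" using M Suc.prems by (simp add: field_simps)
      then have "real t * real n ^ k \<le> real M * (\<delta> / 2) * real n ^ k" by (rule mult_right_mono) simp
      then show ?thesis using L by (simp add: Y)
    qed
    also have "\<dots> \<le> (\<Sum>x\<in>L. real (card (N x)))"
      using L by (intro sum_mono) (auto simp: G_def)
    finally have avg: "(real t - 1 + 1) * real (card Y) \<le> (\<Sum>x\<in>L. real (card (N x)))" .
    obtain T where T: "T \<subseteq> L" "card T = t"
      "1 * real (card Y) \<le> real (card L) * 2 ^ card L * real (card {y \<in> Y. \<forall>x\<in>T. y \<in> N x})"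
      by (rule dense_common_intersection[OF L(3) Y(1) \<open>Y \<noteq> {}\<close> NY t zero_less_one avg])
    define E' where "E' = {y \<in> Y. \<forall>x\<in>T. y \<in> N x}"
    have "\<delta>' * real n ^ k \<le> real (card E')"
      using T(3) \<open>M > 0\<close> L Y by (simp add: \<delta>'_def E'_def field_simps)
    moreover have "E' \<subseteq> {xs. set xs \<subseteq> {..<n} \<and> length xs = k}" by (auto simp: E'_def Y_def)
    ultimately obtain As where As: "length As = k" "\<forall>A\<in>set As. finite A \<and> card A = t" "listset As \<subseteq> E'"
      using n1[rule_format, OF nn(1)] by blast
    have "finite T" using T(1) L(3) finite_subset by blast
    have "listset (T # As) \<subseteq> E" using As(3) by (auto simp: set_Cons_def E'_def N_def)
    then show "\<exists>As. length As = Suc k \<and> (\<forall>A\<in>set As. finite A \<and> card A = t) \<and> listset As \<subseteq> E"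
      using As T(2) \<open>finite T\<close> by (intro exI[of _ "T # As"]) auto
  qed
qed

text \<open>Any injections of the classes \<open>S i\<close> into the disjoint parts \<open>P i\<close> glue to an embedding, since
  they map each edge to a transversal. Completeness is expressed through choice functions \<open>a\<close>, as
  links arise from tuples in the application.\<close>

lemma contains_hypergraph_if_complete_partite:
  assumes F: "r_graph r F" and S: "r_partition r F S"
    and P: "disjoint_family_on P {1..r}" "\<And>i. i \<in> {1..r} \<Longrightarrow> P i \<subseteq> hverts H"
      "\<And>i. i \<in> {1..r} \<Longrightarrow> finite (P i)" "\<And>i. i \<in> {1..r} \<Longrightarrow> card (S i) \<le> card (P i)"
    and trans: "\<And>a. (\<And>i. i \<in> {1..r} \<Longrightarrow> a i \<in> P i) \<Longrightarrow> a ` {1..r} \<in> hedges H"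
  shows "contains_hypergraph H F"
proof -
  have S1: "(\<Union>i\<in>{1..r}. S i) = hverts F" and S2: "disjoint_family_on S {1..r}"
    and S3: "\<And>e i. e \<in> hedges F \<Longrightarrow> i \<in> {1..r} \<Longrightarrow> card (e \<inter> S i) = 1"
    using S by (auto simp: r_partition_def)
  have finS: "finite (S i)" if "i \<in> {1..r}" for i
  proof (rule finite_subset)
    show "S i \<subseteq> hverts F" using S1 that by blast
    show "finite (hverts F)" using F by (simp add: r_graph_def)
  qed
  have "\<exists>f. f ` S i \<subseteq> P i \<and> inj_on f (S i)" if "i \<in> {1..r}" for i
    using card_le_inj[OF finS[OF that] P(3)[OF that] P(4)[OF that]] by blast
  then obtain f where f: "\<And>i. i \<in> {1..r} \<Longrightarrow> f i ` S i \<subseteq> P i \<and> inj_on (f i) (S i)" by metis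
  define idx where "idx x = (THE i. i \<in> {1..r} \<and> x \<in> S i)" for x
  have idx: "idx x = i" if "i \<in> {1..r}" "x \<in> S i" for x i
    unfolding idx_def
  proof (rule the_equality)
    fix j assume j: "j \<in> {1..r} \<and> x \<in> S j"
    show "j = i"
    proof (rule ccontr)
      assume "j \<noteq> i"
      then have "S j \<inter> S i = {}" using disjoint_family_onD[OF S2] j that(1) by blast
      then show False using j that(2) by blast
    qed
  qed (use that in blast)
  define \<phi> where "\<phi> x = f (idx x) x" for x
  have \<phi>: "\<phi> x \<in> P i" "\<phi> x = f i x" if "i \<in> {1..r}" "x \<in> S i" for x i
    using f[OF that(1)] that idx[OF that] by (auto simp: \<phi>_def)
  have "inj_on \<phi> (hverts F)"
  proof (rule inj_onI)
    fix x y assume xy: "x \<in> hverts F" "y \<in> hverts F" "\<phi> x = \<phi> y"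
    obtain i where i: "i \<in> {1..r}" "x \<in> S i" using xy S1 by blast
    obtain j where j: "j \<in> {1..r}" "y \<in> S j" using xy S1 by blast
    have "i = j"
    proof (rule ccontr)
      assume "i \<noteq> j"
      then have "P i \<inter> P j = {}" using disjoint_family_onD[OF P(1) i(1) j(1)] by blast
      then show False using \<phi>(1)[OF i] \<phi>(1)[OF j] xy(3) by auto
    qed
    then show "x = y"
      using f[OF i(1)] i j xy(3) \<phi>(2)[OF i] \<phi>(2)[OF j] by (auto dest: inj_onD)
  qed
  moreover have "\<phi> ` hverts F \<subseteq> hverts H"
  proof (rule image_subsetI)
    fix x assume "x \<in> hverts F"
    then obtain i where "i \<in> {1..r}" "x \<in> S i" using S1 by blast
    then show "\<phi> x \<in> hverts H" using \<phi>(1) P(2) by blast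
  qed
  moreover have "\<phi> ` e \<in> hedges H" if e: "e \<in> hedges F" for e
  proof -
    have "\<exists>b. e \<inter> S i = {b}" if "i \<in> {1..r}" for i
      using S3[OF e that] by (simp add: card_1_singleton_iff)
    then obtain b where b: "\<And>i. i \<in> {1..r} \<Longrightarrow> e \<inter> S i = {b i}" by metis
    have "e \<subseteq> hverts F" using F e by (auto simp: r_graph_def)
    then have "e = (\<Union>i\<in>{1..r}. e \<inter> S i)" using S1 by blast
    also have "\<dots> = b ` {1..r}" using b by auto
    finally have "\<phi> ` e = (\<lambda>i. \<phi> (b i)) ` {1..r}" by (simp add: image_image)
    moreover have "\<phi> (b i) \<in> P i" if "i \<in> {1..r}" for i
      using \<phi>(1)[OF that] b[OF that] by blast
    ultimately show ?thesis using trans[of "\<lambda>i. \<phi> (b i)"] by simp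
  qed
  ultimately show ?thesis unfolding contains_hypergraph_def by blast
qed

section \<open>Partite members of the family\<close>

lemma card_inter_preimage:
  assumes "inj_on \<phi> V" "e \<subseteq> V"
  shows "card (e \<inter> {x \<in> V. \<phi> x \<in> P}) = card (\<phi> ` e \<inter> P)"
proof -
  have img: "\<phi> ` (e \<inter> {x \<in> V. \<phi> x \<in> P}) = \<phi> ` e \<inter> P" using assms(2) by auto
  have "inj_on \<phi> (e \<inter> {x \<in> V. \<phi> x \<in> P})"
    using assms(1) by (rule inj_on_subset) auto
  from card_image[OF this] show ?thesis by (simp only: img)
qed

text \<open>The complete \<open>r\<close>-partite hypergraph with the residue classes modulo \<open>r\<close> as parts has positive
  density, and it contains only \<open>r\<close>-partite hypergraphs. It would be free if no member were \<open>r\<close>-partite,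
  against degeneracy.\<close>

lemma degenerate_family_r_partite_member:
  fixes \<F> :: "'a hypergraph set"
  assumes r: "r \<ge> 1" and fam: "\<forall>F\<in>\<F>. r_graph r F" and deg: "degenerate_family r \<F>"
  shows "\<exists>F\<in>\<F>. r_partite r F"
proof (rule ccontr)
  assume no: "\<not> ?thesis"
  define P where "P i = {x. x mod r = i}" for i
  define E where "E n = {e. e \<subseteq> {..<n} \<and> card e = r \<and> (\<forall>i<r. card (e \<inter> P i) = 1)}" for n
  have finE: "finite (E n)" for n
    by (rule finite_subset[of _ "Pow {..<n}"]) (auto simp: E_def)
  have free: "({..<n}, E n) \<in> free_r_graphs r n \<F>" for n
  proof -
    have "\<not> contains_hypergraph ({..<n}, E n) F" if F: "F \<in> \<F>" for F
    proof
      assume "contains_hypergraph ({..<n}, E n) F"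
      then obtain \<phi> where \<phi>: "inj_on \<phi> (hverts F)" "\<And>e. e \<in> hedges F \<Longrightarrow> \<phi> ` e \<in> E n"
        by (auto simp: contains_hypergraph_def)
      define S where "S i = {x \<in> hverts F. \<phi> x \<in> P (i - 1)}" for i
      have "(\<Union>i\<in>{1..r}. S i) = hverts F"
      proof (intro equalityI subsetI)
        fix x assume x: "x \<in> hverts F"
        have "\<phi> x mod r + 1 \<in> {1..r}" using r by (simp add: Suc_leI)
        moreover have "x \<in> S (\<phi> x mod r + 1)" using x by (simp add: S_def P_def)
        ultimately show "x \<in> (\<Union>i\<in>{1..r}. S i)" by blast
      qed (auto simp: S_def)
      moreover have "disjoint_family_on S {1..r}"
        by (auto simp: disjoint_family_on_def S_def P_def)
      moreover have "card (e \<inter> S i) = 1" if e: "e \<in> hedges F" and i: "i \<in> {1..r}" for e i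
      proof -
        have "e \<subseteq> hverts F" using fam F e by (auto simp: r_graph_def)
        then have "card (e \<inter> S i) = card (\<phi> ` e \<inter> P (i - 1))"
          unfolding S_def by (rule card_inter_preimage[OF \<phi>(1)])
        moreover have "i - 1 < r" using i by auto
        ultimately show ?thesis using \<phi>(2)[OF e] by (simp add: E_def)
      qed
      ultimately have "r_partition r F S" by (simp add: r_partition_def)
      then show False using no F by (auto simp: r_partite_def)
    qed
    then show ?thesis by (auto simp: free_r_graphs_def r_graph_def family_free_def E_def)
  qed
  have many: "m ^ r \<le> card (E (m * r))" for m
  proof -
    \<comment> \<open>\<open>f i * r + i\<close> is the \<open>f i\<close>-th element of the residue class of \<open>i\<close>, so \<open>g\<close> maps choice
      functions injectively to transversals.\<close>
    define g where "g f = (\<lambda>i. f i * r + i) ` {..<r}" for f :: "nat \<Rightarrow> nat"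
    define D where "D = {..<r} \<rightarrow>\<^sub>E {..<m}"
    have gP: "g f \<inter> P i = {f i * r + i}" if "i < r" for f i
      using that by (auto simp: g_def P_def)
    have "g f \<in> E (m * r)" if f: "f \<in> D" for f
    proof -
      have "inj_on (\<lambda>i. f i * r + i) {..<r}"
      proof (rule inj_onI)
        fix i j assume *: "i \<in> {..<r}" "j \<in> {..<r}" "f i * r + i = f j * r + j"
        have "i = (f i * r + i) mod r" using *(1) by simp
        also have "\<dots> = j" unfolding *(3) using *(2) by simp
        finally show "i = j" .
      qed
      then have "card (g f) = r" by (simp add: g_def card_image)
      moreover have "f i * r + i < m * r" if "i < r" for i
      proof -
        have "Suc (f i) \<le> m" using f that by (auto simp: D_def PiE_iff Suc_le_eq)
        then have "Suc (f i) * r \<le> m * r" by (rule mult_le_mono1)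
        then show ?thesis using that by simp
      qed
      then have "g f \<subseteq> {..<m * r}" by (auto simp: g_def)
      ultimately show ?thesis using gP by (simp add: E_def)
    qed
    moreover have "inj_on g D"
    proof (rule inj_onI)
      fix f f' assume f: "f \<in> D" "f' \<in> D" "g f = g f'"
      show "f = f'"
      proof (rule PiE_ext[OF f(1,2)[unfolded D_def]])
        fix i assume "i \<in> {..<r}"
        then have "{f i * r + i} = {f' i * r + i}" using gP[of i f] gP[of i f'] f(3) by simp
        then show "f i = f' i" using r by simp
      qed
    qed
    ultimately have "card D \<le> card (E (m * r))" by (intro card_inj_on_le[of g] finE) auto
    then show ?thesis by (simp add: D_def card_PiE)
  qed
  have "(1 / real r) ^ r > 0" using r by simp
  with deg have "\<forall>\<^sub>F n in sequentially. real (ex_edges r n \<F>) / real (n choose r) < (1 / real r) ^ r"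
    unfolding degenerate_family_def by (rule order_tendstoD)
  then obtain n0 where n0: "\<And>n. n \<ge> n0 \<Longrightarrow> real (ex_edges r n \<F>) / real (n choose r) < (1 / real r) ^ r"
    unfolding eventually_sequentially by blast
  define m where "m = n0 + 1"
  have mr: "m * r \<ge> n0" "m * r \<ge> r" 
    using mult_le_mono2[OF r, of m] mult_le_mono1[of 1 m r] by (simp_all add: m_def)
  have "(1 / real r) ^ r * real ((m * r) choose r) \<le> (1 / real r) ^ r * real ((m * r) ^ r)"
    using mr by (intro mult_left_mono of_nat_mono binomial_le_pow) auto
  also have "\<dots> = real (m ^ r)" using r by (simp add: power_mult_distrib power_divide)
  also have "\<dots> \<le> real (ex_edges r (m * r) \<F>)"
    using many[of m] card_hedges_le_ex_edges[OF free[of "m * r"]] by (intro of_nat_mono) simp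
  finally have "(1 / real r) ^ r \<le> real (ex_edges r (m * r) \<F>) / real ((m * r) choose r)"
    using mr by (simp add: pos_le_divide_eq del: of_nat_mult)
  with n0[OF mr(1)] show False by linarith
qed

lemma tau_part_family_attained:
  assumes "\<exists>F\<in>\<F>. r_partite r F"
  obtains F S where "F \<in> \<F>" "r_partition r F S" "card (S 1) = tau_part_family r \<F>"
proof -
  have "tau_part_family r \<F> \<in> tau_part r ` {F \<in> \<F>. r_partite r F}"
    unfolding tau_part_family_def using assms by (intro Inf_nat_def1) auto
  then obtain F where F: "F \<in> \<F>" "r_partite r F" "tau_part r F = tau_part_family r \<F>" by auto
  have "tau_part r F \<in> {card (S 1) | S. r_partition r F S}"
    unfolding tau_part_def using F(2) by (intro Inf_nat_def1) (auto simp: r_partite_def)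
  then obtain S where "r_partition r F S" "card (S 1) = tau_part r F" by auto
  then show ?thesis using that[OF F(1), of S] F(3) by simp
qed

text \<open>Each edge of a graph has two vertices, hence exactly one outside an independent cover.\<close>

lemma r_partition_2_complement:
  assumes F: "r_graph 2 F" and S: "S \<subseteq> hverts F" "\<And>e. e \<in> hedges F \<Longrightarrow> card (e \<inter> S) = 1"
  shows "r_partition 2 F (\<lambda>i. if i = 1 then S else hverts F - S)"
proof -
  have "card (e \<inter> (hverts F - S)) = 1" if e: "e \<in> hedges F" for e
  proof -
    have *: "e \<subseteq> hverts F" "card e = 2" "finite e"
      using F e by (auto simp: r_graph_def intro: finite_subset)
    then have "e \<inter> (hverts F - S) = e - e \<inter> S" by blast
    then show ?thesis using S(2)[OF e] * by (simp add: card_Diff_subset)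
  qed
  moreover have "{1..2} = {1, 2::nat}" by auto
  ultimately show ?thesis
    using S by (auto simp: r_partition_def disjoint_family_on_def)
qed

lemma tau_part_2_eq_tau_ind:
  assumes "r_graph 2 F"
  shows "tau_part 2 F = tau_ind F"
proof -
  have "{card (S 1) | S. r_partition 2 F S}
      = {card S | S. S \<subseteq> hverts F \<and> (\<forall>e\<in>hedges F. card (e \<inter> S) = 1)}"
    (is "?A = ?B")
  proof (intro equalityI subsetI)
    fix k assume "k \<in> ?A"
    then obtain S where S: "k = card (S 1)" "r_partition 2 F S" by blast
    then have "S 1 \<subseteq> hverts F \<and> (\<forall>e\<in>hedges F. card (e \<inter> S 1) = 1)"
      unfolding r_partition_def by fastforce
    then show "k \<in> ?B" using S by blast
  next
    fix k assume "k \<in> ?B"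
    then obtain S where "k = card S" "S \<subseteq> hverts F" "\<And>e. e \<in> hedges F \<Longrightarrow> card (e \<inter> S) = 1" by blast
    then show "k \<in> ?A"
      using r_partition_2_complement[OF assms, of S] by (intro CollectI exI conjI) auto
  qed
  then show ?thesis by (simp add: tau_part_def tau_ind_def)
qed

lemma tau_part_family_2:
  assumes "\<forall>F\<in>\<F>. r_graph 2 F"
  shows "tau_part_family 2 \<F> = tau_ind_family 2 \<F>"
proof -
  have "tau_part 2 ` {F \<in> \<F>. r_partite 2 F} = tau_ind ` {F \<in> \<F>. r_partite 2 F}"
    using assms tau_part_2_eq_tau_ind by (intro image_cong) auto
  then show ?thesis by (simp add: tau_part_family_def tau_ind_family_def)
qed

text \<open>The extremal construction for graphs is the complete bipartite graph with a part of size
  \<open>s < tau_ind_family 2 \<F>\<close>: a member of the family embedded in it would be independently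
  covered by the at most \<open>s\<close> vertices mapped into that part.\<close>

lemma complete_bipartite_in_free_r_graphs:
  fixes \<F> :: "'a hypergraph set"
  assumes fam: "\<forall>F\<in>\<F>. r_graph 2 F" and s: "s < tau_ind_family 2 \<F>"
  shows "({..<n}, {{a, b} | a b. a < s \<and> s \<le> b \<and> b < n \<and> a < n}) \<in> free_r_graphs 2 n \<F>"
    (is "?K \<in> _")
proof -
  have "\<not> contains_hypergraph ?K F" if F: "F \<in> \<F>" for F
  proof
    assume "contains_hypergraph ?K F"
    then obtain \<phi> where \<phi>: "inj_on \<phi> (hverts F)" "\<And>e. e \<in> hedges F \<Longrightarrow> \<phi> ` e \<in> hedges ?K"
      unfolding contains_hypergraph_def by blast
    define S where "S = {x \<in> hverts F. \<phi> x \<in> {..<s}}"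
    have S: "S \<subseteq> hverts F" by (auto simp: S_def)
    have cover: "card (e \<inter> S) = 1" if e: "e \<in> hedges F" for e
    proof -
      have "e \<subseteq> hverts F" using fam F e by (auto simp: r_graph_def)
      then have "card (e \<inter> S) = card (\<phi> ` e \<inter> {..<s})"
        unfolding S_def by (rule card_inter_preimage[OF \<phi>(1)])
      moreover obtain a b where ab: "\<phi> ` e = {a, b}" "a < s" "s \<le> b" using \<phi>(2)[OF e] by auto
      moreover have "{a, b} \<inter> {..<s} = {a}" using ab by auto
      ultimately show ?thesis by simp
    qed
    have "r_partite 2 F"
      using r_partition_2_complement[of F S] fam F S cover unfolding r_partite_def by blast
    then have "tau_ind_family 2 \<F> \<le> tau_ind F"
      unfolding tau_ind_family_def using F by (intro cInf_lower) auto
    also have "\<dots> \<le> card S"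
      unfolding tau_ind_def using S cover by (intro cInf_lower) auto
    also have "\<dots> \<le> card {..<s}"
      using inj_on_subset[OF \<phi>(1) S] by (intro card_inj_on_le[of \<phi>]) (auto simp: S_def)
    finally show False using s by simp
  qed
  moreover have "r_graph 2 ?K" by (auto simp: r_graph_def)
  ultimately show ?thesis by (auto simp: free_r_graphs_def family_free_def)
qed

lemma degree_norm_complete_bipartite:
  assumes "s \<le> n"
  shows "real s * (real n - real s) powr p
    \<le> degree_norm p ({..<n}, {{a, b} | a b. a < s \<and> s \<le> b \<and> b < n \<and> a < n})"
    (is "_ \<le> degree_norm p ?K")
proof -
  have deg: "hdegree ?K a = n - s" if a: "a < s" for a
  proof -
    have "{e \<in> hedges ?K. a \<in> e} = (\<lambda>b. {a, b}) ` {s..<n}"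
    proof (intro equalityI subsetI)
      fix e assume "e \<in> (\<lambda>b. {a, b}) ` {s..<n}"
      then obtain b where b: "e = {a, b}" "s \<le> b" "b < n" by auto
      then have "a < s \<and> s \<le> b \<and> b < n \<and> a < n" using a assms by simp
      then have "e \<in> hedges ?K" using b(1) unfolding snd_conv by blast
      then show "e \<in> {e \<in> hedges ?K. a \<in> e}" using b(1) by simp
    qed (use a in auto)
    moreover have "inj_on (\<lambda>b. {a, b}) {s..<n}"
      using a by (auto simp: inj_on_def doubleton_eq_iff)
    ultimately show ?thesis by (simp add: hdegree_def card_image)
  qed
  have "real s * (real n - real s) powr p = (\<Sum>a<s. real (hdegree ?K a) powr p)"
    using assms by (simp add: deg of_nat_diff)
  also have "\<dots> \<le> (\<Sum>a<n. real (hdegree ?K a) powr p)"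
    using assms by (intro sum_mono2) auto
  finally show ?thesis by (simp add: degree_norm_def)
qed

section \<open>Vertices of very large degree\<close>

lemma hdegree_eq_card_link:
  assumes H: "H \<in> free_r_graphs r n \<F>" and r: "r \<ge> 1"
  shows "hdegree H v = card {e. e \<subseteq> {..<n} \<and> card e = r - 1 \<and> v \<notin> e \<and> insert v e \<in> hedges H}"
proof -
  note HD = free_r_graphsD[OF H]
  let ?A = "{e \<in> hedges H. v \<in> e}"
  let ?B = "{e. e \<subseteq> {..<n} \<and> card e = r - 1 \<and> v \<notin> e \<and> insert v e \<in> hedges H}"
  have "bij_betw (\<lambda>e. e - {v}) ?A ?B"
  proof (rule bij_betw_byWitness[where f' = "insert v"])
    show "(\<lambda>e. e - {v}) ` ?A \<subseteq> ?B"
    proof (rule image_subsetI)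
      fix e assume "e \<in> ?A"
      then have e: "e \<in> hedges H" "v \<in> e" by auto
      have "e - {v} \<subseteq> {..<n}" using HD(2)[OF e(1)] by blast
      moreover have "card (e - {v}) = r - 1" using HD(2)[OF e(1)] e(2) by simp
      moreover have "insert v (e - {v}) \<in> hedges H" using e by (simp add: insert_absorb)
      ultimately show "e - {v} \<in> ?B" by simp
    qed
  qed auto
  then show ?thesis unfolding hdegree_def by (rule bij_betw_same_card)
qed

lemma hdegree_le_choose:
  assumes H: "H \<in> free_r_graphs r n \<F>" and r: "r \<ge> 1"
  shows "hdegree H v \<le> n choose (r - 1)"
proof -
  have fin: "finite {e. e \<subseteq> {..<n} \<and> card e = r - 1}"
    by (rule finite_subset[of _ "Pow {..<n}"]) auto
  have "hdegree H v \<le> card {e. e \<subseteq> {..<n} \<and> card e = r - 1}"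
    unfolding hdegree_eq_card_link[OF assms] by (rule card_mono[OF fin]) auto
  then show ?thesis by (simp add: n_subsets)
qed

text \<open>If boundedly many vertices had degree sum at least \<open>(\<tau> - 1 + \<delta>) * (n choose (r - 1))\<close>,
  then \<open>\<tau>\<close> of them would have a common link of positive density. This link contains a complete
  \<open>(r - 1)\<close>-partite hypergraph with large parts, and together with the \<open>\<tau>\<close> vertices these parts host
  the hypergraph \<open>F\<close>, whose first class has only \<open>\<tau>\<close> vertices.\<close>

lemma sum_top_hdegree_less:
  fixes \<F> :: "'a hypergraph set" and \<delta> :: real
  assumes r: "r \<ge> 2" and F: "F \<in> \<F>" "r_graph r F" and S: "r_partition r F S"
    and \<tau>: "card (S 1) = \<tau>" "\<tau> \<ge> 1" and \<delta>: "\<delta> > 0"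
  shows "\<forall>\<^sub>F n in sequentially. \<forall>H\<in>free_r_graphs r n \<F>. \<forall>L. L \<subseteq> {..<n} \<longrightarrow> card L = M \<longrightarrow>
    (\<Sum>v\<in>L. real (hdegree H v)) < (real \<tau> - 1 + \<delta>) * real (n choose (r - 1))"
proof -
  define k where "k = r - 1"
  have k: "k \<ge> 1" "r = Suc k" using r by (auto simp: k_def)
  define t where "t = max 1 (card (hverts F))"
  have t: "t \<ge> 1" by (simp add: t_def)
  \<comment> \<open>The factor \<open>Suc M\<close> instead of \<open>M\<close> keeps \<open>D\<close> positive for \<open>M = 0\<close>.\<close>
  define D where "D = real (Suc M) * 2 ^ M"
  have D: "D > 0" by (simp add: D_def)
  define \<delta>' where "\<delta>' = \<delta> / (D * real k ^ k)"
  have "\<delta>' > 0" using \<delta> D k by (simp add: \<delta>'_def)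
  from dense_tuples_contain_box[OF this t, of k]
  obtain n0 where n0: "\<forall>n\<ge>n0. \<forall>E. E \<subseteq> {xs. set xs \<subseteq> {..<n} \<and> length xs = k} \<longrightarrow>
      \<delta>' * real n ^ k \<le> real (card E) \<longrightarrow>
      (\<exists>As. length As = k \<and> (\<forall>A\<in>set As. finite A \<and> card A = t) \<and> listset As \<subseteq> E)"
    by (rule exE)
  show ?thesis
    unfolding eventually_sequentially
  proof (intro exI[of _ "max n0 k"] allI impI ballI)
    fix n H L
    assume n: "max n0 k \<le> n" and H: "H \<in> free_r_graphs r n \<F>" and L: "L \<subseteq> {..<n}" "card L = M"
    note HD = free_r_graphsD[OF H]
    have finL: "finite L" using L(1) finite_subset by blast
    define Y where "Y = {e. e \<subseteq> {..<n} \<and> card e = k}"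
    have finY: "finite Y" unfolding Y_def by (rule finite_subset[of _ "Pow {..<n}"]) auto
    have cY: "card Y = n choose k" unfolding Y_def by (simp add: n_subsets)
    have "card Y > 0" unfolding cY using n by simp
    then have Y0: "Y \<noteq> {}" by auto
    define E where "E v = {e. e \<subseteq> {..<n} \<and> card e = k \<and> v \<notin> e \<and> insert v e \<in> hedges H}" for v
    have EY: "E v \<subseteq> Y" for v by (auto simp: E_def Y_def)
    have cE: "card (E v) = hdegree H v" for v
      using hdegree_eq_card_link[OF H, of v] r by (simp add: E_def k_def)
    show "(\<Sum>v\<in>L. real (hdegree H v)) < (real \<tau> - 1 + \<delta>) * real (n choose (r - 1))"
    proof (rule ccontr)
      assume "\<not> ?thesis"
      then have avg: "(real \<tau> - 1 + \<delta>) * real (card Y) \<le> (\<Sum>v\<in>L. real (card (E v)))"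
        by (simp add: cE cY k_def)
      obtain T where T: "T \<subseteq> L" "card T = \<tau>"
        "\<delta> * real (card Y) \<le> real (card L) * 2 ^ card L * real (card {y \<in> Y. \<forall>x\<in>T. y \<in> E x})"
        by (rule dense_common_intersection[OF finL finY Y0 EY \<tau>(2) \<delta> avg])
      define C where "C = {y \<in> Y. \<forall>x\<in>T. y \<in> E x}"
      have CY: "C \<subseteq> Y" by (auto simp: C_def)
      have "\<delta> * real (card Y) \<le> D * real (card C)"
      proof -
        have "real (card L) * 2 ^ card L \<le> D" by (simp add: L(2) D_def)
        then have "real (card L) * 2 ^ card L * real (card C) \<le> D * real (card C)"
          by (rule mult_right_mono) simp
        then show ?thesis using T(3) by (simp add: C_def)
      qed
      moreover have "(real n / real k) ^ k \<le> real (card Y)"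
        unfolding cY using n by (intro binomial_ge_n_over_k_pow_k) simp
      ultimately have "\<delta> * (real n / real k) ^ k \<le> D * real (card C)"
        using mult_left_mono[of "(real n / real k) ^ k" "real (card Y)" \<delta>] \<delta> by linarith
      then have dens: "\<delta>' * real n ^ k \<le> real (card C)"
        using D k by (simp add: \<delta>'_def power_divide field_simps)
      define EE where "EE = {xs. length xs = k \<and> set xs \<in> C}"
      have EEsub: "EE \<subseteq> {xs. set xs \<subseteq> {..<n} \<and> length xs = k}"
        using CY by (auto simp: EE_def Y_def)
      have finEE: "finite EE" by (rule finite_subset[OF EEsub]) (simp add: finite_lists_length_eq)
      have "C \<subseteq> set ` EE"
      proof
        fix e assume e: "e \<in> C"
        then have "e \<in> Y" using CY by blast
        then have e': "card e = k" "finite e" by (auto simp: Y_def intro: finite_subset)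
        from finite_distinct_list[OF e'(2)] obtain xs where xs: "set xs = e" "distinct xs" by blast
        have "length xs = k" using distinct_card[OF xs(2)] xs(1) e'(1) by simp
        then have "xs \<in> EE" using xs(1) e by (simp add: EE_def)
        then show "e \<in> set ` EE" using xs(1) by (intro image_eqI[of _ _ xs]) simp_all
      qed
      then have "card C \<le> card EE" by (rule surj_card_le[OF finEE])
      then have "\<delta>' * real n ^ k \<le> real (card EE)" using dens by linarith
      then obtain As where As: "length As = k" "\<And>A. A \<in> set As \<Longrightarrow> finite A \<and> card A = t" "listset As \<subseteq> EE"
        using n0[rule_format, of n EE] EEsub n by auto
      \<comment> \<open>Classes are numbered from \<open>1\<close>, and \<open>As\<close> from \<open>0\<close>; its entries serve the classes from \<open>2\<close> on.\<close>
      define P where "P i = (if i = 1 then T else As ! (i - 2))" for i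
      have P: "finite (P i) \<and> P i \<noteq> {}" if i: "i \<in> {1..r}" for i
      proof (cases "i = 1")
        case True
        then show ?thesis using T finite_subset[OF T(1) finL] \<tau>(2) by (auto simp: P_def)
      next
        case False
        then have "As ! (i - 2) \<in> set As" using i As(1) k by (intro nth_mem) auto
        then show ?thesis using As(2)[of "As ! (i - 2)"] t False by (auto simp: P_def)
      qed
      have trans: "a ` {1..r} \<in> hedges H \<and> inj_on a {1..r}"
        if a: "\<And>i. i \<in> {1..r} \<Longrightarrow> a i \<in> P i" for a
      proof -
        define xs where "xs = map (\<lambda>i. a (i + 2)) [0..<k]"
        have "xs \<in> listset As"
          unfolding listset_iff list_all2_conv_all_nth
        proof (intro conjI allI impI)
          show "length xs = length As" by (simp add: xs_def As(1))
          fix i assume i: "i < length xs"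
          then have "a (i + 2) \<in> P (i + 2)" using k by (intro a) (simp add: xs_def)
          then show "xs ! i \<in> As ! i" using i by (simp add: xs_def P_def)
        qed
        then have "set xs \<in> C" using As(3) by (auto simp: EE_def)
        moreover have "a 1 \<in> T" using a[of 1] r by (simp add: P_def)
        ultimately have ins: "insert (a 1) (set xs) \<in> hedges H" by (auto simp: C_def E_def)
        have "{2..r} = (\<lambda>i. i + 2) ` {0..<k}"
        proof (intro equalityI subsetI)
          fix i assume "i \<in> {2..r}"
          then have "i - 2 \<in> {0..<k}" "i = i - 2 + 2" using k by auto
          then show "i \<in> (\<lambda>i. i + 2) ` {0..<k}" by blast
        qed (use k in auto)
        then have "set xs = a ` {2..r}" by (simp add: xs_def image_image)
        moreover have "{1..r} = insert 1 {2..r}" using r by auto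
        ultimately have e: "a ` {1..r} \<in> hedges H" using ins by simp
        then have "card (a ` {1..r}) = card {1..r}" using HD(2) by simp
        then have "inj_on a {1..r}" by (rule eq_card_imp_inj_on[rotated]) simp
        then show ?thesis using e by simp
      qed
      \<comment> \<open>A default transversal: every transversal is an edge with \<open>r\<close> vertices, so replacing
        one or two coordinates of \<open>c\<close> shows that the parts are disjoint and consist of vertices of \<open>H\<close>.\<close>
      define c where "c i = (SOME x. x \<in> P i)" for i
      have c: "c i \<in> P i" if "i \<in> {1..r}" for i
        unfolding c_def using P[OF that] by (simp add: some_in_eq)
      have "contains_hypergraph H F"
      proof (rule contains_hypergraph_if_complete_partite[OF F(2) S, of P])
        show "disjoint_family_on P {1..r}"
          unfolding disjoint_family_on_def
        proof (intro ballI impI equals0I)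
          fix i j x assume ij: "i \<in> {1..r}" "j \<in> {1..r}" "i \<noteq> j" and x: "x \<in> P i \<inter> P j"
          have "inj_on (c(i := x, j := x)) {1..r}" using c x by (intro conjunct2[OF trans]) auto
          then show False using ij by (auto dest: inj_onD[of _ _ i j])
        qed
        show "P i \<subseteq> hverts H" if i: "i \<in> {1..r}" for i
        proof
          fix x assume "x \<in> P i"
          then have "(c(i := x)) ` {1..r} \<in> hedges H" using c by (intro conjunct1[OF trans]) auto
          then have "(c(i := x)) ` {1..r} \<subseteq> {..<n}" using HD(2) by blast
          then have "(c(i := x)) i \<in> {..<n}" using i by blast
          then show "x \<in> hverts H" by (simp add: HD(1))
        qed
        show "finite (P i)" if "i \<in> {1..r}" for i using P[OF that] by blast
        show "card (S i) \<le> card (P i)" if i: "i \<in> {1..r}" for i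
        proof (cases "i = 1")
          case True
          then show ?thesis using \<tau>(1) T(2) by (simp add: P_def)
        next
          case False
          then have "As ! (i - 2) \<in> set As" using i As(1) k by (intro nth_mem) auto
          then have "card (P i) = t" using As(2) False by (simp add: P_def)
          moreover have "S i \<subseteq> hverts F" using S i unfolding r_partition_def by blast
          then have "card (S i) \<le> card (hverts F)"
            using F(2) by (intro card_mono) (auto simp: r_graph_def)
          ultimately show ?thesis by (simp add: t_def)
        qed
        show "a ` {1..r} \<in> hedges H" if "\<And>i. i \<in> {1..r} \<Longrightarrow> a i \<in> P i" for a
          using trans[of a] that by blast
      qed
      then show False using HD(4)[OF F(1)] by blast
    qed
  qed
qed

section \<open>The degree norm below and above the threshold\<close>

text \<open>The integral of \<open>x powr - s\<close> as an upper bound, by induction. The increment of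
  \<open>x powr (1 - s)\<close> is estimated through an inequality between weighted means.\<close>

lemma sum_powr_le:
  fixes s :: real
  assumes s: "0 < s" "s < 1"
  shows "(\<Sum>i<n. real (Suc i) powr - s) \<le> real n powr (1 - s) / (1 - s)"
proof (induction n)
  case (Suc n)
  define x where "x = real (Suc n)"
  have x: "x > 0" by (simp add: x_def)
  have "real n powr (1 - s) * x powr s \<le> (1 - s) * real n + s * x"
  proof (cases "n = 0")
    case False
    then show ?thesis using Youngs_inequality_0[of "1 - s" s "real n" x] s x by simp
  qed (use s x in simp)
  also have "\<dots> = x - (1 - s)" by (simp add: x_def algebra_simps)
  finally have *: "real n powr (1 - s) * x powr s * x powr - s \<le> (x - (1 - s)) * x powr - s"
    by (rule mult_right_mono) simp
  have e1: "real n powr (1 - s) * x powr s * x powr - s = real n powr (1 - s)"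
    using x by (simp add: mult.assoc powr_add[symmetric])
  have e2: "x * x powr - s = x powr (1 - s)" using x powr_add[of x 1 "- s"] by simp
  have "(1 - s) * x powr - s + real n powr (1 - s) \<le> x powr (1 - s)"
    using * unfolding e1 left_diff_distrib[of x] e2 by linarith
  then have "((1 - s) * x powr - s + real n powr (1 - s)) / (1 - s) \<le> x powr (1 - s) / (1 - s)"
    using s by (intro divide_right_mono) auto
  then have "x powr - s + real n powr (1 - s) / (1 - s) \<le> x powr (1 - s) / (1 - s)"
    using s by (simp add: add_divide_distrib)
  then show ?case using Suc.IH by (simp add: x_def)
qed simp

lemma degree_norm_reindex:
  assumes "hverts H = {..<n}" "bij_betw \<sigma> {..<n} {..<n}"
  shows "degree_norm p H = (\<Sum>i<n. real (hdegree H (\<sigma> i)) powr p)"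
  unfolding degree_norm_def assms(1) by (rule sum.reindex_bij_betw[OF assms(2), symmetric])

text \<open>For \<open>\<beta> * p < 1\<close> the sum of the powers \<open>(i + 1) powr - (\<beta> * p)\<close> over \<open>i < n\<close> is of order
  \<open>n powr (1 - \<beta> * p)\<close>: in the resulting bound the many vertices of small degree dominate.\<close>

lemma degree_norm_le_subcritical:
  fixes \<F> :: "'a hypergraph set" and p \<beta> C :: real
  assumes H: "H \<in> free_r_graphs r n \<F>" and \<sigma>: "bij_betw \<sigma> {..<n} {..<n}"
    and d: "\<And>i. i < n \<Longrightarrow> real (hdegree H (\<sigma> i)) \<le> C * real n ^ k * real (Suc i) powr - \<beta>"
    and C: "C \<ge> 0" and p: "p > 0" and s: "0 < \<beta> * p" "\<beta> * p < 1"
  shows "degree_norm p H \<le> C powr p / (1 - \<beta> * p) * real n powr (1 + p * (real k - \<beta>))"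
proof (cases "n = 0")
  case True
  then show ?thesis using free_r_graphsD(1)[OF H] by (simp add: degree_norm_def)
next
  case False
  have "degree_norm p H = (\<Sum>i<n. real (hdegree H (\<sigma> i)) powr p)"
    by (rule degree_norm_reindex[OF free_r_graphsD(1)[OF H] \<sigma>])
  also have "\<dots> \<le> (\<Sum>i<n. (C * real n ^ k * real (Suc i) powr - \<beta>) powr p)"
    using d p by (intro sum_mono powr_mono2) auto
  also have "\<dots> = (\<Sum>i<n. C powr p * (real n ^ k) powr p * real (Suc i) powr - (\<beta> * p))"
    by (intro sum.cong refl) (simp add: powr_mult powr_powr del: of_nat_Suc)
  also have "\<dots> = C powr p * (real n ^ k) powr p * (\<Sum>i<n. real (Suc i) powr - (\<beta> * p))"
    by (rule sum_distrib_left[symmetric])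
  also have "\<dots> \<le> C powr p * (real n ^ k) powr p * (real n powr (1 - \<beta> * p) / (1 - \<beta> * p))"
    by (intro mult_left_mono sum_powr_le s) auto
  also have "(real n ^ k) powr p = real n powr (real k * p)"
    using False by (simp add: powr_realpow[symmetric] powr_powr)
  also have "C powr p * real n powr (real k * p) * (real n powr (1 - \<beta> * p) / (1 - \<beta> * p))
      = C powr p / (1 - \<beta> * p) * (real n powr (real k * p) * real n powr (1 - \<beta> * p))" by simp
  also have "real n powr (real k * p) * real n powr (1 - \<beta> * p) = real n powr (1 + p * (real k - \<beta>))"
    unfolding powr_add[symmetric] by (simp add: algebra_simps)
  finally show ?thesis .
qed

text \<open>For \<open>\<beta> * p > 1\<close> the same powers are summable: all but a constant number \<open>M\<close> of vertices
  contribute at most \<open>\<delta> / 2\<close> in the scale of \<open>(n choose (r - 1)) powr p\<close>. On the \<open>M\<close> vertices of largest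
  degree the exponent \<open>p > 1\<close> only helps, since every normalised degree is at most \<open>1\<close>, and their
  degree sum has been bounded already.\<close>

lemma eventually_ex_norm_le_supercritical:
  fixes \<F> :: "'a hypergraph set" and p \<beta> C \<delta> :: real
  assumes r: "r \<ge> 2" and fam: "\<forall>F\<in>\<F>. hedges F \<noteq> {}"
    and F: "F \<in> \<F>" "r_graph r F" and S: "r_partition r F S" and \<tau>: "card (S 1) = \<tau>" "\<tau> \<ge> 1"
    and d: "\<And>n H \<sigma> i. H \<in> free_r_graphs r n \<F> \<Longrightarrow> bij_betw \<sigma> {..<n} {..<n} \<Longrightarrow>
        (\<And>i j. i \<le> j \<Longrightarrow> j < n \<Longrightarrow> hdegree H (\<sigma> j) \<le> hdegree H (\<sigma> i)) \<Longrightarrow> i < n \<Longrightarrow>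
        real (hdegree H (\<sigma> i)) \<le> C * real n ^ (r - 1) * real (Suc i) powr - \<beta>"
    and C: "C \<ge> 0" and p: "p > 1" and s: "\<beta> * p > 1" and \<delta>: "\<delta> > 0"
  shows "\<forall>\<^sub>F n in sequentially.
    ex_norm r p n \<F> \<le> (real \<tau> - 1 + \<delta>) * real (n choose (r - 1)) powr p"
proof -
  define k where "k = r - 1"
  have k: "k \<ge> 1" using r by (simp add: k_def)
  define B where "B = C * real k ^ k"
  have B: "B \<ge> 0" using C by (simp add: B_def)
  define f where "f i = real (Suc i) powr - (\<beta> * p)" for i
  have f0: "f i \<ge> 0" for i by (simp add: f_def)
  have "summable (\<lambda>i. real i powr - (\<beta> * p))" using s by (simp add: summable_real_powr_iff)
  then have sf: "summable f" unfolding f_def by (subst summable_Suc_iff)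
  \<comment> \<open>The summand \<open>1\<close> avoids a division by zero in case \<open>B = 0\<close>.\<close>
  define \<eta> where "\<eta> = \<delta> / (2 * (B powr p + 1))"
  have "B powr p + 1 > 0" by (simp add: add_nonneg_pos)
  then have \<eta>: "\<eta> > 0" "B powr p * \<eta> \<le> \<delta> / 2"
    using \<delta> by (simp_all add: \<eta>_def field_simps)
  obtain M where M: "norm (\<Sum>i. f (i + M)) < \<eta>"
    using suminf_exist_split[OF \<eta>(1) sf] by blast
  have tail: "(\<Sum>i\<in>{M..<n}. f i) \<le> \<eta>" if "M \<le> n" for n
  proof -
    have "(\<Sum>i\<in>{M..<n}. f i) = (\<Sum>i<n - M. f (i + M))"
      using sum.shift_bounds_nat_ivl[of f 0 M "n - M"] that by (simp add: atLeast0LessThan)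
    also have "\<dots> \<le> (\<Sum>i. f (i + M))"
      using sf f0 by (intro sum_le_suminf) (auto simp: summable_iff_shift)
    finally show ?thesis using M by simp
  qed
  have "\<delta> / 2 > 0" using \<delta> by simp
  from sum_top_hdegree_less[OF r F S \<tau> this, of M] eventually_ge_at_top[of "max M r"]
  show ?thesis
  proof eventually_elim
    case (elim n)
    define b where "b = real (n choose (r - 1))"
    have b: "b \<ge> 0" by (simp add: b_def)
    have n: "M \<le> n" "k \<le> n" using elim(2) by (simp_all add: k_def le_diff_conv trans_le_add1)
    have nb: "real n ^ k \<le> real k ^ k * b"
    proof -
      have "(real n / real k) ^ k \<le> b"
        unfolding b_def using n(2) by (simp only: k_def[symmetric] binomial_ge_n_over_k_pow_k)
      then show ?thesis using k by (simp add: power_divide field_simps)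
    qed
    show ?case
    proof (rule ex_norm_leI[OF fam])
      fix H assume H: "H \<in> free_r_graphs r n \<F>"
      obtain \<sigma> where \<sigma>: "bij_betw \<sigma> {..<n} {..<n}"
        and dec: "\<And>i j. i \<le> j \<Longrightarrow> j < n \<Longrightarrow> hdegree H (\<sigma> j) \<le> hdegree H (\<sigma> i)"
        using decreasing_enumeration[of n "hdegree H"] by blast
      define g where "g i = real (hdegree H (\<sigma> i))" for i
      have gb: "g i \<le> b" for i
        unfolding g_def b_def using hdegree_le_choose[OF H] r by simp
      have top: "(\<Sum>i<M. g i powr p) \<le> (real \<tau> - 1 + \<delta> / 2) * b powr p"
      proof -
        have inj: "inj_on \<sigma> {..<M}"
          using bij_betw_imp_inj_on[OF \<sigma>] n(1) by (elim inj_on_subset) auto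
        have sub: "\<sigma> ` {..<M} \<subseteq> {..<n}"
          using image_mono[of "{..<M}" "{..<n}" \<sigma>] bij_betw_imp_surj_on[OF \<sigma>] n(1) by auto
        have "(\<Sum>v\<in>\<sigma> ` {..<M}. real (hdegree H v)) < (real \<tau> - 1 + \<delta> / 2) * b"
          unfolding b_def using elim(1) H sub card_image[OF inj] by simp
        then have sumg: "(\<Sum>i<M. g i) \<le> (real \<tau> - 1 + \<delta> / 2) * b"
          by (simp add: sum.reindex[OF inj] g_def)
        have "(\<Sum>i<M. g i powr p) \<le> (\<Sum>i<M. g i * b powr (p - 1))"
        proof (rule sum_mono)
          fix i
          have "g i powr p = g i * g i powr (p - 1)"
            using powr_add[of "g i" 1 "p - 1"] by (simp add: g_def)
          also have "\<dots> \<le> g i * b powr (p - 1)"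
            using gb p by (intro mult_left_mono powr_mono2) (auto simp: g_def)
          finally show "g i powr p \<le> g i * b powr (p - 1)" .
        qed
        also have "\<dots> = (\<Sum>i<M. g i) * b powr (p - 1)" by (rule sum_distrib_right[symmetric])
        also have "\<dots> \<le> (real \<tau> - 1 + \<delta> / 2) * b * b powr (p - 1)"
          using sumg by (rule mult_right_mono) simp
        also have "b * b powr (p - 1) = b powr p"
          using powr_add[of b 1 "p - 1"] b by simp
        then have "(real \<tau> - 1 + \<delta> / 2) * b * b powr (p - 1) = (real \<tau> - 1 + \<delta> / 2) * b powr p"
          by (simp only: mult.assoc)
        finally show ?thesis .
      qed
      have rest: "(\<Sum>i\<in>{M..<n}. g i powr p) \<le> \<delta> / 2 * b powr p"
      proof -
        have "(\<Sum>i\<in>{M..<n}. g i powr p) \<le> (\<Sum>i\<in>{M..<n}. B powr p * b powr p * f i)"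
        proof (rule sum_mono)
          fix i assume "i \<in> {M..<n}"
          then have "g i \<le> C * real n ^ k * real (Suc i) powr - \<beta>"
            unfolding g_def k_def by (intro d[OF H \<sigma> dec]) auto
          also have "\<dots> \<le> C * (real k ^ k * b) * real (Suc i) powr - \<beta>"
            using nb C by (intro mult_right_mono mult_left_mono) auto
          also have "\<dots> = B * b * real (Suc i) powr - \<beta>" by (simp add: B_def)
          finally have "g i powr p \<le> (B * b * real (Suc i) powr - \<beta>) powr p"
            using p by (intro powr_mono2) (auto simp: g_def)
          also have "\<dots> = B powr p * b powr p * f i"
            unfolding f_def powr_mult powr_powr by simp
          finally show "g i powr p \<le> B powr p * b powr p * f i" .
        qed
        also have "\<dots> = B powr p * b powr p * (\<Sum>i\<in>{M..<n}. f i)"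
          by (rule sum_distrib_left[symmetric])
        also have "\<dots> \<le> B powr p * b powr p * \<eta>"
          using tail[OF n(1)] by (intro mult_left_mono) auto
        also have "\<dots> = B powr p * \<eta> * b powr p" by simp
        also have "\<dots> \<le> \<delta> / 2 * b powr p" using \<eta>(2) by (rule mult_right_mono) simp
        finally show ?thesis .
      qed
      have split: "{..<n} = {..<M} \<union> {M..<n}" using n(1) by auto
      have "degree_norm p H = (\<Sum>i<n. g i powr p)"
        unfolding g_def by (rule degree_norm_reindex[OF free_r_graphsD(1)[OF H] \<sigma>])
      also have "\<dots> = (\<Sum>i<M. g i powr p) + (\<Sum>i\<in>{M..<n}. g i powr p)"
        unfolding split by (rule sum.union_disjoint) auto
      also have "\<dots> \<le> (real \<tau> - 1 + \<delta> / 2) * b powr p + \<delta> / 2 * b powr p"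
        by (rule add_mono[OF top rest])
      also have "\<dots> = (real \<tau> - 1 + \<delta>) * b powr p" by (simp add: algebra_simps)
      finally show "degree_norm p H \<le> (real \<tau> - 1 + \<delta>) * real (n choose (r - 1)) powr p"
        by (simp add: b_def)
    qed
  qed
qed

lemma smallo_oneI:
  fixes \<epsilon> :: "nat \<Rightarrow> real"
  assumes "\<And>\<delta>. \<delta> > 0 \<Longrightarrow> \<forall>\<^sub>F n in sequentially. \<bar>\<epsilon> n\<bar> \<le> \<delta>"
  shows "\<epsilon> \<in> o(\<lambda>_. 1)"
  by (rule landau_o.smallI) (use assms in simp)

theorem theorem1p2:
  fixes r :: nat and p \<alpha> :: real and \<F> :: "'a hypergraph set"
  assumes "r \<ge> 2" and "p > 1"
    and "\<forall>F\<in>\<F>. r_graph r F \<and> hedges F \<noteq> {}"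
    and "degenerate_family r \<F>"
    and "real r - 2 \<le> \<alpha>" and "\<alpha> < real r - 1"
    and "(\<lambda>n. real (ex_edges r n \<F>)) \<in> O(\<lambda>n. real n powr (1 + \<alpha>))"
  shows "(\<exists>C>0.
            (p < 1 / (real r - 1 - \<alpha>) \<longrightarrow>
               (\<forall>n. ex_norm r p n \<F> \<le> C * real n powr (1 + p * \<alpha>))) \<and>
            (p > 1 / (real r - 1 - \<alpha>) \<longrightarrow>
               (\<exists>\<epsilon> :: nat \<Rightarrow> real. \<epsilon> \<in> o(\<lambda>_. 1) \<and>
                  (\<forall>n. ex_norm r p n \<F> \<le>
                     (real (tau_part_family r \<F>) - 1 + \<epsilon> n) * real (n choose (r - 1)) powr p)))) \<and>
         (r = 2 \<longrightarrow> p > 1 / (1 - \<alpha>) \<longrightarrow>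
            (\<exists>\<epsilon> :: nat \<Rightarrow> real. \<epsilon> \<in> o(\<lambda>_. 1) \<and>
               (\<forall>n. ex_norm r p n \<F> =
                  (real (tau_ind_family r \<F>) - 1 + \<epsilon> n) * real n powr p)))"
proof -
  note r = assms(1) and p = assms(2)
  define \<beta> where "\<beta> = real r - 1 - \<alpha>"
  have \<beta>: "\<beta> > 0" using assms(6) by (simp add: \<beta>_def)
  have r1: "r \<ge> 1" and \<alpha>: "1 + \<alpha> \<ge> 0" using r assms(5) by auto
  have fam: "\<forall>F\<in>\<F>. r_graph r F" and edges: "\<forall>F\<in>\<F>. hedges F \<noteq> {}" using assms(3) by auto
  have zero: "ex_norm r p n \<F> = 0" if n: "n < r" for n
  proof (rule antisym)
    show "ex_norm r p n \<F> \<le> 0"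
      by (rule ex_norm_leI[OF edges]) (simp add: degree_norm_no_edges[OF _ n])
    show "0 \<le> ex_norm r p n \<F>"
      using degree_norm_le_ex_norm[OF edgeless_in_free_r_graphs[OF edges], of p n r]
      by (simp add: degree_norm_no_edges[OF edgeless_in_free_r_graphs[OF edges] n])
  qed
  have "ex_edges r 0 \<F> = 0"
  proof -
    have "(\<lambda>H. card (hedges H)) ` free_r_graphs r 0 \<F> = {0}"
    proof (intro equalityI subsetI)
      fix k assume "k \<in> (\<lambda>H. card (hedges H)) ` free_r_graphs r 0 \<F>"
      then obtain H where H: "H \<in> free_r_graphs r 0 \<F>" "k = card (hedges H)" by blast
      have "hedges H = {}" using free_r_graphsD(2)[OF H(1)] r by fastforce
      then show "k \<in> {0}" using H(2) by simp
    next
      fix k assume "k \<in> {0::nat}"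
      then show "k \<in> (\<lambda>H. card (hedges H)) ` free_r_graphs r 0 \<F>"
        using edgeless_in_free_r_graphs[OF edges, of 0 r]
        by (intro image_eqI[of _ _ "({..<0}, {})"]) auto
    qed
    then show ?thesis by (simp add: ex_edges_def)
  qed
  then obtain K where K: "K \<ge> 0" "\<And>n. real (ex_edges r n \<F>) \<le> K * real n powr (1 + \<alpha>)"
    using bigo_powr_bound[OF assms(7) _ \<alpha>] by auto
  define C where "C = real r * 2 ^ (r - 1) * K * real r powr (1 + \<alpha>)"
  have C: "C \<ge> 0" using K(1) by (simp add: C_def)
  have decay: "real (hdegree H (\<sigma> i)) \<le> C * real n ^ (r - 1) * real (Suc i) powr - \<beta>"
    if "H \<in> free_r_graphs r n \<F>" "bij_betw \<sigma> {..<n} {..<n}"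
      "\<And>i j. i \<le> j \<Longrightarrow> j < n \<Longrightarrow> hdegree H (\<sigma> j) \<le> hdegree H (\<sigma> i)" "i < n" for H \<sigma> i n
    unfolding C_def \<beta>_def
  proof (rule decreasing_degree_le[OF that(1) _ _ that(3) fam r1 K(2) \<alpha> K(1) that(4)])
    show "inj_on \<sigma> {..<n}" "\<sigma> ` {..<n} \<subseteq> {..<n}" using that(2) by (auto simp: bij_betw_def)
  qed
  have "\<exists>F\<in>\<F>. r_partite r F"
    using degenerate_family_r_partite_member[OF r1 fam assms(4)] .
  then obtain F S where F: "F \<in> \<F>" and S: "r_partition r F S" and \<tau>: "card (S 1) = tau_part_family r \<F>"
    by (rule tau_part_family_attained)
  have Fr: "r_graph r F" using F fam by blast
  have \<tau>1: "tau_part_family r \<F> \<ge> 1"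
  proof -
    obtain e where e: "e \<in> hedges F" using edges F by blast
    have "card (e \<inter> S 1) = 1" using S e r1 by (simp add: r_partition_def)
    moreover have "S 1 \<subseteq> hverts F" using S r1 unfolding r_partition_def by fastforce
    then have "finite (S 1)" using Fr finite_subset by (auto simp: r_graph_def)
    ultimately have "1 \<le> card (S 1)" using card_mono[of "S 1" "e \<inter> S 1"] by simp
    then show ?thesis unfolding \<tau> .
  qed
  have upper: "\<forall>\<^sub>F n in sequentially. ex_norm r p n \<F> \<le>
      (real (tau_part_family r \<F>) - 1 + \<delta>) * real (n choose (r - 1)) powr p"
    if "\<delta> > 0" "p > 1 / \<beta>" for \<delta>
  proof (rule eventually_ex_norm_le_supercritical[OF r edges F Fr S \<tau> \<tau>1 _ C p _ that(1), where \<beta> = \<beta>])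
    show "real (hdegree H (\<sigma> i)) \<le> C * real n ^ (r - 1) * real (Suc i) powr - \<beta>"
      if "H \<in> free_r_graphs r n \<F>" "bij_betw \<sigma> {..<n} {..<n}"
        "\<And>i j. i \<le> j \<Longrightarrow> j < n \<Longrightarrow> hdegree H (\<sigma> j) \<le> hdegree H (\<sigma> i)" "i < n" for n H \<sigma> i
      using that by (rule decay)
    show "\<beta> * p > 1" using that(2) \<beta> by (simp add: field_simps)
  qed
  have part1: "\<exists>C'>0. \<forall>n. ex_norm r p n \<F> \<le> C' * real n powr (1 + p * \<alpha>)" if sub: "p < 1 / \<beta>"
  proof -
    have s: "0 < \<beta> * p" "\<beta> * p < 1" using sub \<beta> p by (simp_all add: field_simps)
    define C' where "C' = C powr p / (1 - \<beta> * p)"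
    have C': "C' \<ge> 0" using s by (simp add: C'_def)
    have "ex_norm r p n \<F> \<le> (C' + 1) * real n powr (1 + p * \<alpha>)" for n
    proof (rule ex_norm_leI[OF edges])
      fix H assume H: "H \<in> free_r_graphs r n \<F>"
      obtain \<sigma> where \<sigma>: "bij_betw \<sigma> {..<n} {..<n}"
        and dec: "\<And>i j. i \<le> j \<Longrightarrow> j < n \<Longrightarrow> hdegree H (\<sigma> j) \<le> hdegree H (\<sigma> i)"
        using decreasing_enumeration[of n "hdegree H"] by blast
      have "degree_norm p H \<le> C' * real n powr (1 + p * (real (r - 1) - \<beta>))"
        unfolding C'_def
        by (rule degree_norm_le_subcritical[OF H \<sigma> decay[OF H \<sigma> dec] C _ s]) (use p in auto)
      also have "real (r - 1) - \<beta> = \<alpha>" using r1 by (simp add: \<beta>_def of_nat_diff)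
      also have "C' * real n powr (1 + p * \<alpha>) \<le> (C' + 1) * real n powr (1 + p * \<alpha>)"
        by (rule mult_right_mono) auto
      finally show "degree_norm p H \<le> (C' + 1) * real n powr (1 + p * \<alpha>)" .
    qed
    then show ?thesis using C' by (intro exI[of _ "C' + 1"]) auto
  qed
  have part2: "\<exists>\<epsilon> :: nat \<Rightarrow> real. \<epsilon> \<in> o(\<lambda>_. 1) \<and> (\<forall>n. ex_norm r p n \<F> \<le>
      (real (tau_part_family r \<F>) - 1 + \<epsilon> n) * real (n choose (r - 1)) powr p)" if super: "p > 1 / \<beta>"
  proof -
    define b where "b n = real (n choose (r - 1)) powr p" for n
    define T where "T = real (tau_part_family r \<F>) - 1"
    \<comment> \<open>The normalised degree norm may stay below \<open>T\<close>, where only an upper bound is claimed; the maximum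
      keeps \<open>\<epsilon>\<close> from becoming negative there.\<close>
    define \<epsilon> where "\<epsilon> n = max 0 (ex_norm r p n \<F> / b n - T)" for n
    have "ex_norm r p n \<F> \<le> (T + \<epsilon> n) * b n" for n
    proof (cases "n < r - 1")
      case True
      then show ?thesis using zero[of n] by (simp add: b_def binomial_eq_0)
    next
      case False
      then have "0 < n choose (r - 1)" by (intro zero_less_binomial) simp
      then have "b n > 0" unfolding b_def by simp
      moreover have "ex_norm r p n \<F> / b n \<le> T + \<epsilon> n" by (simp add: \<epsilon>_def)
      ultimately show ?thesis by (simp add: pos_divide_le_eq)
    qed
    moreover have "\<epsilon> \<in> o(\<lambda>_. 1)"
    proof (rule smallo_oneI)
      fix \<delta> :: real assume "\<delta> > 0"
      from upper[OF this super] eventually_ge_at_top[of r]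
      show "\<forall>\<^sub>F n in sequentially. \<bar>\<epsilon> n\<bar> \<le> \<delta>"
      proof eventually_elim
        case (elim n)
        then have "0 < n choose (r - 1)" by (intro zero_less_binomial) simp
        then have "b n > 0" unfolding b_def by simp
        then have "ex_norm r p n \<F> / b n \<le> T + \<delta>" using elim(1) by (simp add: b_def T_def pos_divide_le_eq)
        then show ?case using \<open>\<delta> > 0\<close> by (simp add: \<epsilon>_def)
      qed
    qed
    ultimately show ?thesis unfolding T_def b_def by blast
  qed
  have part3: "\<exists>\<epsilon> :: nat \<Rightarrow> real. \<epsilon> \<in> o(\<lambda>_. 1) \<and> (\<forall>n. ex_norm r p n \<F> =
      (real (tau_ind_family r \<F>) - 1 + \<epsilon> n) * real n powr p)" if r2: "r = 2" and super: "p > 1 / \<beta>"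
  proof -
    have fam2: "\<forall>F\<in>\<F>. r_graph 2 F" using fam r2 by simp
    have \<tau>2: "tau_part_family r \<F> = tau_ind_family 2 \<F>" using tau_part_family_2[OF fam2] r2 by simp
    define s where "s = tau_ind_family 2 \<F> - 1"
    have s: "s < tau_ind_family 2 \<F>" "real (tau_ind_family 2 \<F>) - 1 = real s"
      using \<tau>1 \<tau>2 by (simp_all add: s_def of_nat_diff)
    define \<epsilon> where "\<epsilon> n = ex_norm r p n \<F> / real n powr p - real s" for n
    have "ex_norm r p n \<F> = (real s + \<epsilon> n) * real n powr p" for n
    proof (cases "n = 0")
      case True
      then show ?thesis using zero[of 0] r by simp
    qed (simp add: \<epsilon>_def)
    moreover have "\<epsilon> \<in> o(\<lambda>_. 1)"
    proof (rule smallo_oneI)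
      fix \<delta> :: real assume \<delta>: "\<delta> > 0"
      have "(\<lambda>n. real s / real n) \<longlonglongrightarrow> 0" by (rule lim_const_over_n)
      then have "(\<lambda>n. real s * (1 - real s / real n) powr p) \<longlonglongrightarrow> real s * (1 - 0) powr p"
        by (intro tendsto_intros) auto
      then have "\<forall>\<^sub>F n in sequentially. real s - \<delta> < real s * (1 - real s / real n) powr p"
        by (rule order_tendstoD) (use \<delta> in simp)
      moreover note upper[OF \<delta> super]
      moreover note eventually_ge_at_top[of "max 1 s"]
      ultimately show "\<forall>\<^sub>F n in sequentially. \<bar>\<epsilon> n\<bar> \<le> \<delta>"
      proof eventually_elim
        case (elim n)
        then have n: "n > 0" "s \<le> n" by auto
        then have np: "real n powr p > 0" by simp
        have "ex_norm r p n \<F> \<le> (real s + \<delta>) * real n powr p"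
          using elim(2) s(2) by (simp add: r2 \<tau>2[unfolded r2])
        then have "ex_norm r p n \<F> / real n powr p \<le> real s + \<delta>"
          unfolding pos_divide_le_eq[OF np] .
        then have up: "\<epsilon> n \<le> \<delta>" unfolding \<epsilon>_def by linarith
        have "real s * (1 - real s / real n) powr p * real n powr p
            = real s * ((1 - real s / real n) * real n) powr p"
          by (simp add: powr_mult)
        also have "(1 - real s / real n) * real n = real n - real s"
          using n by (simp add: field_simps)
        also have "real s * (real n - real s) powr p \<le> ex_norm r p n \<F>"
          using degree_norm_complete_bipartite[OF n(2)]
            degree_norm_le_ex_norm[OF complete_bipartite_in_free_r_graphs[OF fam2 s(1)]]
          unfolding r2 by (rule order_trans)
        finally have "real s * (1 - real s / real n) powr p \<le> ex_norm r p n \<F> / real n powr p"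
          unfolding pos_le_divide_eq[OF np] .
        then show ?case using up elim(1) unfolding \<epsilon>_def by linarith
      qed
    qed
    ultimately show ?thesis using s(2) by (auto simp: r2)
  qed
  have "\<exists>C>0. (p < 1 / \<beta> \<longrightarrow> (\<forall>n. ex_norm r p n \<F> \<le> C * real n powr (1 + p * \<alpha>)))"
  proof (cases "p < 1 / \<beta>")
    case True
    then show ?thesis using part1 by blast
  qed (auto intro: exI[of _ 1])
  moreover have "1 - \<alpha> = \<beta>" if "r = 2" using that by (simp add: \<beta>_def)
  ultimately show ?thesis using part2 part3 unfolding \<beta>_def[symmetric] by metis
qed

end
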